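(* Up to isometries of $\mathcal{H}_3$, the minimal graphs in $\mathcal{H}_3$ with Gauss map of rank $1$ are the graphs of the functions $$f_k(x,y)=\frac{xy}{2}-\frac{k}{2}\Big[y\sqrt{1+y^2}+\ln\big(y+\sqrt{1+y^2}\big)\Big],\qquad k\in\mathbb{R}.$$ That is: for each $k\in\mathbb{R}$ the graph of $f_k$ is a minimal surface whose Gauss map has rank $1$ at every point; and if $\Omega\subset\mathbb{R}^2$ is a connected open set and $f:\Omega\to\mathbb{R}$ is a smooth function whose graph is a minimal surface in $\mathcal{H}_3$ with Gauss map of rank $1$ at every point, then there are $k\in\mathbb{R}$ and an isometry of $\mathcal{H}_3$ mapping the graph of $f$ onto an open subset of the graph of $f_k$.
   Context: The Heisenberg group $\mathcal{H}_3$ is $\mathbb{R}^3$ with the product $(x_1,y_1,z_1)*(x_2,y_2,z_2)=(x_1+x_2,\,y_1+y_2,\,z_1+z_2+\frac{x_1y_2-x_2y_1}{2})$, equipped with the left-invariant Riemannian metric $ds^2=dx^2+dy^2+(\frac12 y\,dx-\frac12 x\,dy+dz)^2$. For $p\in\mathcal{H}_3$ let $L_p$ denote left translation by $p$. For an oriented surface $S\subset\mathcal{H}_3$ with unit normal field $\eta$, the Gauss map is $\gamma:S\to S^2=\{v\in\mathfrak{h}_3:|v|=1\}$, $\gamma(p)=(dL_p)^{-1}(\eta(p))$, where $\mathfrak{h}_3=T_e\mathcal{H}_3$. The Gauss map has rank $1$ if the linear map $d\gamma_p$ has rank $1$ at every $p\in S$; for a graph of a smooth function $f$ this is the condition $f_{xx}f_{yy}-f_{xy}^2+\frac14=0$.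 A surface is minimal if its mean curvature vanishes identically. *)

theory Defs
  imports "HOL-Analysis.Analysis"
begin

text \<open>
  The manifold underlying the Heisenberg group is \<open>\<real>\<^sup>3\<close> with its global chart; every tangent space,
  and in particular the Lie algebra \<open>T\<^sub>e\<close> at \<open>e = 0\<close>, is identified with \<open>\<real>\<^sup>3\<close> through the
  coordinate frame \<open>\<partial>\<^sub>x, \<partial>\<^sub>y, \<partial>\<^sub>z\<close>.
\<close>

type_synonym h3 = "real \<times> real \<times> real"

fun heis_mult :: "h3 \<Rightarrow> h3 \<Rightarrow> h3" where
  "heis_mult (x1, y1, z1) (x2, y2, z2) =
     (x1 + x2, y1 + y2, z1 + z2 + (x1 * y2 - x2 * y1) / 2)"

fun heis_metric :: "h3 \<Rightarrow> h3 \<Rightarrow> h3 \<Rightarrow> real" where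
  "heis_metric (x, y, z) (u1, u2, u3) (v1, v2, v3) =
     u1 * v1 + u2 * v2 + (y * u1 / 2 - x * u2 / 2 + u3) * (y * v1 / 2 - x * v2 / 2 + v3)"

text \<open>
  \<open>C\<^sup>n\<close> and \<open>C\<^sup>\<infinity>\<close> maps. The derivatives are those at points of the full space, so these notions
  are meant for open \<open>S\<close>.
\<close>

primrec Ck_on :: "nat \<Rightarrow> 'a::real_normed_vector set \<Rightarrow> ('a \<Rightarrow> 'b::real_normed_vector) \<Rightarrow> bool" where
  "Ck_on 0 S f \<longleftrightarrow> continuous_on S f"
| "Ck_on (Suc n) S f \<longleftrightarrow>
     (\<forall>x\<in>S. f differentiable (at x)) \<and> (\<forall>v. Ck_on n S (\<lambda>x. frechet_derivative f (at x) v))"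

definition smooth_on :: "'a::real_normed_vector set \<Rightarrow> ('a \<Rightarrow> 'b::real_normed_vector) \<Rightarrow> bool" where
  "smooth_on S f \<longleftrightarrow> (\<forall>n. Ck_on n S f)"

definition heis_isometry :: "(h3 \<Rightarrow> h3) \<Rightarrow> bool" where
  "heis_isometry \<phi> \<longleftrightarrow>
     bij \<phi> \<and> smooth_on UNIV \<phi> \<and> smooth_on UNIV (inv \<phi>) \<and>
     (\<forall>p u v. heis_metric (\<phi> p) (frechet_derivative \<phi> (at p) u) (frechet_derivative \<phi> (at p) v)
              = heis_metric p u v)"

text \<open>
  Surfaces are given by a global parametrization \<open>X\<close> on an open set \<open>U\<close> of the plane; the surface
  itself is \<open>X ` U\<close>, and the unit normal field \<open>\<eta>\<close> is a function of the point of the surface.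
\<close>

definition oriented_surface :: "(real \<times> real) set \<Rightarrow> (real \<times> real \<Rightarrow> h3) \<Rightarrow> (h3 \<Rightarrow> h3) \<Rightarrow> bool" where
  "oriented_surface U X \<eta> \<longleftrightarrow>
     open U \<and> smooth_on U X \<and> inj_on X U \<and>
     (\<forall>u\<in>U. inj (frechet_derivative X (at u))) \<and>
     continuous_on (X ` U) \<eta> \<and>
     (\<forall>u\<in>U. heis_metric (X u) (\<eta> (X u)) (\<eta> (X u)) = 1 \<and>
            (\<forall>a. heis_metric (X u) (\<eta> (X u)) (frechet_derivative X (at u) a) = 0))"

text \<open>
  The Christoffel symbols \<open>\<Gamma>\<^sub>p(v, w) = \<Sum> \<Gamma>\<^sup>k\<^sub>i\<^sub>j v\<^sup>i w\<^sup>j \<partial>\<^sub>k\<close> of the Levi-Civita connection, in the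
  index-free form of Koszul's formula for constant coordinate fields. The vector is unique because
  the metric is nondegenerate.
\<close>

definition heis_christoffel :: "h3 \<Rightarrow> h3 \<Rightarrow> h3 \<Rightarrow> h3" where
  "heis_christoffel p v w = (THE c. \<forall>a. heis_metric p c a =
     (frechet_derivative (\<lambda>q. heis_metric q w a) (at p) v
      + frechet_derivative (\<lambda>q. heis_metric q v a) (at p) w
      - frechet_derivative (\<lambda>q. heis_metric q v w) (at p) a) / 2)"

text \<open>The covariant derivative \<open>\<nabla>\<^sub>a (dX b)\<close> along the parametrization, for constant \<open>a, b\<close>.\<close>

definition cov_deriv :: "(real \<times> real \<Rightarrow> h3) \<Rightarrow> real \<times> real \<Rightarrow> real \<times> real \<Rightarrow> real \<times> real \<Rightarrow> h3" where
  "cov_deriv X u a b =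
     frechet_derivative (\<lambda>w. frechet_derivative X (at w) b) (at u) a
     + heis_christoffel (X u) (frechet_derivative X (at u) a) (frechet_derivative X (at u) b)"

definition first_form :: "(real \<times> real \<Rightarrow> h3) \<Rightarrow> real \<times> real \<Rightarrow> real \<times> real \<Rightarrow> real \<times> real \<Rightarrow> real" where
  "first_form X u a b =
     heis_metric (X u) (frechet_derivative X (at u) a) (frechet_derivative X (at u) b)"

definition second_form ::
    "(real \<times> real \<Rightarrow> h3) \<Rightarrow> (h3 \<Rightarrow> h3) \<Rightarrow> real \<times> real \<Rightarrow> real \<times> real \<Rightarrow> real \<times> real \<Rightarrow> real" where
  "second_form X \<eta> u a b = heis_metric (X u) (cov_deriv X u a b) (\<eta> (X u))"

text \<open>Half the trace of the second with respect to the first fundamental form.\<close>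

definition mean_curvature ::
    "(real \<times> real \<Rightarrow> h3) \<Rightarrow> (h3 \<Rightarrow> h3) \<Rightarrow> real \<times> real \<Rightarrow> real" where
  "mean_curvature X \<eta> u =
     (let E = first_form X u (1, 0) (1, 0);
          F = first_form X u (1, 0) (0, 1);
          G = first_form X u (0, 1) (0, 1);
          l = second_form X \<eta> u (1, 0) (1, 0);
          m = second_form X \<eta> u (1, 0) (0, 1);
          n = second_form X \<eta> u (0, 1) (0, 1)
      in (E * n - 2 * F * m + G * l) / (2 * (E * G - F\<^sup>2)))"

definition gauss_map :: "(h3 \<Rightarrow> h3) \<Rightarrow> h3 \<Rightarrow> h3" where
  "gauss_map \<eta> p = inv (frechet_derivative (heis_mult p) (at 0)) (\<eta> p)"

text \<open>
  Replacing \<open>\<eta>\<close> by \<open>- \<eta>\<close> only changes the sign of the mean curvature and of the Gauss map, so for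
  connected \<open>U\<close> the choice of \<open>\<eta>\<close> in the next two definitions is immaterial.
  As \<open>dX\<close> maps isomorphically onto the tangent plane, the rank of \<open>d\<gamma>\<close> at \<open>X u\<close> is that of the
  derivative of \<open>\<gamma> \<circ> X\<close> at \<open>u\<close>.
\<close>

definition minimal_surface :: "(real \<times> real) set \<Rightarrow> (real \<times> real \<Rightarrow> h3) \<Rightarrow> bool" where
  "minimal_surface U X \<longleftrightarrow>
     (\<exists>\<eta>. oriented_surface U X \<eta> \<and> (\<forall>u\<in>U. mean_curvature X \<eta> u = 0))"

definition gauss_map_rank_one :: "(real \<times> real) set \<Rightarrow> (real \<times> real \<Rightarrow> h3) \<Rightarrow> bool" where
  "gauss_map_rank_one U X \<longleftrightarrow>
     (\<exists>\<eta>. oriented_surface U X \<eta> \<and>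
          (\<forall>u\<in>U. \<exists>D. ((gauss_map \<eta> \<circ> X) has_derivative D) (at u) \<and> dim (range D) = 1))"

definition graph_param :: "(real \<times> real \<Rightarrow> real) \<Rightarrow> real \<times> real \<Rightarrow> h3" where
  "graph_param f = (\<lambda>(x, y). (x, y, f (x, y)))"

definition graph_on :: "(real \<times> real) set \<Rightarrow> (real \<times> real \<Rightarrow> real) \<Rightarrow> h3 set" where
  "graph_on U f = graph_param f ` U"

definition rank_one_fun :: "real \<Rightarrow> real \<times> real \<Rightarrow> real" where
  "rank_one_fun k = (\<lambda>(x, y).
     x * y / 2 - k / 2 * (y * sqrt (1 + y\<^sup>2) + ln (y + sqrt (1 + y\<^sup>2))))"

end

theory Submission
  imports Defs
begin

text \<open>
  In the left-invariant frame the graph of \<open>f\<close> has tangent vectors \<open>E\<^sub>1 + p E\<^sub>3\<close> and \<open>E\<^sub>2 + q E\<^sub>3\<close>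
  with \<open>p = f\<^sub>x + y/2\<close> and \<open>q = f\<^sub>y - x/2\<close>. Its Gauss map is \<open>(-p, -q, 1) / \<surd>(1 + p\<^sup>2 + q\<^sup>2)\<close>, and the surface is
  minimal iff \<open>(1 + q\<^sup>2) f\<^sub>x\<^sub>x - 2 p q f\<^sub>x\<^sub>y + (1 + p\<^sup>2) f\<^sub>y\<^sub>y = 0\<close>. Rank one means that the differential of
  \<open>(p, q)\<close> has a kernel line field. Differentiating both equations once, at a point and in the
  frame given by that line, shows that the line field is parallel. After a rotation the kernel is the
  \<open>x\<close>-direction; then \<open>p - y\<close> and \<open>q / \<surd>(1 + p\<^sup>2)\<close> have vanishing gradient, and \<open>f\<close> is recovered by
  integration up to a left translation. The line field is handled through the cosine and sine of
  its doubled angle, which are rational in the second derivatives, so that no continuous choice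
  of an angle is needed.
\<close>

section \<open>Smooth maps and mixed partial derivatives\<close>

text \<open>Derivatives at points of an open set depend only on values in that set, so agreement on
  \<open>S\<close> is inherited at every order.\<close>

lemma Ck_on_cong:
  assumes "open S" "\<And>x. x \<in> S \<Longrightarrow> f x = g x"
  shows "Ck_on n S f \<longleftrightarrow> Ck_on n S g"
  using assms(2)
proof (induction n arbitrary: f g)
  case 0
  then show ?case by (auto cong: continuous_on_cong)
next
  case (Suc n)
  have diff: "f differentiable (at x) \<longleftrightarrow> g differentiable (at x)" if "x \<in> S" for x
    unfolding differentiable_def using has_derivative_transform_within_open[OF _ \<open>open S\<close> that] Suc.prems by metis
  have "Ck_on n S (\<lambda>x. frechet_derivative f (at x) v) \<longleftrightarrow> Ck_on n S (\<lambda>x. frechet_derivative g (at x) v)"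
    if "\<forall>x\<in>S. f differentiable (at x)" for v
    using that Suc.prems
    by (intro Suc.IH) (metis frechet_derivative_transform_within_open[OF _ \<open>open S\<close>])
  then show ?case using diff by auto
qed

text \<open>Lets an explicitly known derivative stand in for \<open>frechet_derivative\<close> in
  the recursion defining \<open>Ck_on\<close>.\<close>

lemma Ck_on_SucI:
  assumes "open S" "\<And>x. x \<in> S \<Longrightarrow> (f has_derivative f' x) (at x)"
    "\<And>v. Ck_on n S (\<lambda>x. f' x v)"
  shows "Ck_on (Suc n) S f"
proof -
  have "frechet_derivative f (at x) = f' x" if "x \<in> S" for x
    using assms(2)[OF that] frechet_derivative_at by metis
  then have "Ck_on n S (\<lambda>x. frechet_derivative f (at x) v)" for v
    using Ck_on_cong[OF assms(1), of "\<lambda>x. frechet_derivative f (at x) v" "\<lambda>x. f' x v"] assms(3) by simp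
  then show ?thesis
    using assms(2) by (auto simp: differentiable_def)
qed

lemma Ck_on_SucD:
  assumes "Ck_on (Suc n) S f"
  shows "Ck_on n S f"
  using assms
proof (induction n arbitrary: f)
  case 0
  then show ?case
    by (auto intro!: continuous_at_imp_continuous_on differentiable_imp_continuous_within)
next
  case (Suc n)
  then show ?case by (auto simp del: Ck_on.simps(1))
qed

lemma smooth_on_has_derivative:
  assumes "smooth_on S f" "x \<in> S"
  shows "(f has_derivative frechet_derivative f (at x)) (at x)"
  using assms frechet_derivative_works unfolding smooth_on_def by (metis Ck_on.simps(2))

lemma smooth_on_frechet_derivative:
  assumes "smooth_on S f"
  shows "smooth_on S (\<lambda>x. frechet_derivative f (at x) v)"
  using assms unfolding smooth_on_def by (metis Ck_on.simps(2))

lemma smooth_on_continuous_on: "smooth_on S f \<Longrightarrow> continuous_on S f"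
  unfolding smooth_on_def by (metis Ck_on.simps(1))

section \<open>Closure of C^n maps under algebraic operations\<close>

lemma Ck_on_const: "open S \<Longrightarrow> Ck_on n S (\<lambda>x. c)"
proof (induction n arbitrary: c)
  case (Suc n)
  show ?case
    by (rule Ck_on_SucI[where f' = "\<lambda>_ _. 0"]) (use Suc in auto)
qed auto

lemma Ck_on_bounded_linear:
  assumes "open S" "bounded_linear f"
  shows "Ck_on n S f"
proof (cases n)
  case 0
  then show ?thesis
    using assms by (simp add: linear_continuous_on)
next
  case (Suc m)
  show ?thesis unfolding Suc
    by (rule Ck_on_SucI[where f' = "\<lambda>_. f"])
       (use assms in \<open>auto intro: Ck_on_const bounded_linear_imp_has_derivative\<close>)
qed

lemma Ck_on_add:
  assumes "open S" "Ck_on n S f" "Ck_on n S g"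
  shows "Ck_on n S (\<lambda>x. f x + g x)"
  using assms(2-)
proof (induction n arbitrary: f g)
  case 0
  then show ?case by (auto intro: continuous_on_add)
next
  case (Suc n)
  show ?case
    by (rule Ck_on_SucI[where f' = "\<lambda>x v. frechet_derivative f (at x) v + frechet_derivative g (at x) v"])
       (use Suc assms(1) in \<open>auto intro!: has_derivative_add simp: frechet_derivative_works[symmetric]\<close>)
qed

lemma Ck_on_mult:
  fixes f g :: "'a::real_normed_vector \<Rightarrow> real"
  assumes "open S" "Ck_on n S f" "Ck_on n S g"
  shows "Ck_on n S (\<lambda>x. f x * g x)"
  using assms(2-)
proof (induction n arbitrary: f g)
  case 0
  then show ?case by (auto intro: continuous_on_mult)
next
  case (Suc n)
  \<comment> \<open>The product rule brings back the undifferentiated factors, which are therefore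
    needed at order \<open>n\<close> as well.\<close>
  have "Ck_on n S f" "Ck_on n S g" using Suc.prems Ck_on_SucD by blast+
  then show ?case
    by (intro Ck_on_SucI[where f' = "\<lambda>x v. f x * frechet_derivative g (at x) v + frechet_derivative f (at x) v * g x"])
       (use Suc assms(1) in \<open>auto intro!: has_derivative_mult Ck_on_add simp: frechet_derivative_works[symmetric]\<close>)
qed

lemma Ck_on_Pair:
  assumes "open S" "Ck_on n S f" "Ck_on n S g"
  shows "Ck_on n S (\<lambda>x. (f x, g x))"
  using assms(2-)
proof (induction n arbitrary: f g)
  case 0
  then show ?case by (auto intro: continuous_on_Pair)
next
  case (Suc n)
  show ?case
    by (rule Ck_on_SucI[where f' = "\<lambda>x v. (frechet_derivative f (at x) v, frechet_derivative g (at x) v)"])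
       (use Suc assms(1) in \<open>auto intro!: has_derivative_Pair simp: frechet_derivative_works[symmetric]\<close>)
qed

text \<open>Schwarz's theorem. Two mean value steps, taken in either order, write the second
  difference of \<open>f\<close> over a small square as h^2 times a value of \<open>f12\<close> and
  as h^2 times a value of \<open>f21\<close>; by continuity both values are close to those at
  \<open>u\<close>.\<close>

lemma mixed_partials_eq:
  fixes f :: "real \<times> real \<Rightarrow> real"
  assumes S: "open S" "u \<in> S"
    and f: "\<And>w. w \<in> S \<Longrightarrow> (f has_derivative (\<lambda>h. f1 w * fst h + f2 w * snd h)) (at w)"
    and f1: "\<And>w. w \<in> S \<Longrightarrow> (f1 has_derivative (\<lambda>h. f11 w * fst h + f12 w * snd h)) (at w)"
    and f2: "\<And>w. w \<in> S \<Longrightarrow> (f2 has_derivative (\<lambda>h. f21 w * fst h + f22 w * snd h)) (at w)"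
    and cont: "continuous_on S f12" "continuous_on S f21"
  shows "f12 u = f21 u"
proof -
  obtain x y where u: "u = (x, y)" by (cases u)
  have along_x: "((\<lambda>s. g (s, b)) has_real_derivative g1 (a, b)) (at a)"
    if "(g has_derivative (\<lambda>h. g1 (a, b) * fst h + g2 (a, b) * snd h)) (at (a, b))" for g g1 g2 a b
  proof -
    have "((\<lambda>s. (s, b)) has_derivative (\<lambda>h. (h, 0))) (at a)"
      by (auto intro!: derivative_eq_intros)
    from has_derivative_compose[OF this that] show ?thesis
      by (simp add: has_field_derivative_def mult.commute[of "g1 (a, b)"] mult_commute_abs)
  qed
  have along_y: "((\<lambda>s. g (a, s)) has_real_derivative g2 (a, b)) (at b)"
    if "(g has_derivative (\<lambda>h. g1 (a, b) * fst h + g2 (a, b) * snd h)) (at (a, b))" for g g1 g2 a b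
  proof -
    have "((\<lambda>s. (a, s)) has_derivative (\<lambda>h. (0, h))) (at b)"
      by (auto intro!: derivative_eq_intros)
    from has_derivative_compose[OF this that] show ?thesis
      by (simp add: has_field_derivative_def mult_commute_abs)
  qed
  have "\<bar>f12 u - f21 u\<bar> \<le> e" if "e > 0" for e
  proof -
    have "isCont f12 u" "isCont f21 u"
      using S cont by (auto simp: continuous_on_eq_continuous_at)
    then have "\<forall>\<^sub>F w in nhds u. dist (f12 w) (f12 u) < e / 2" "\<forall>\<^sub>F w in nhds u. dist (f21 w) (f21 u) < e / 2"
      using \<open>e > 0\<close> unfolding isCont_def tendsto_at_iff_tendsto_nhds by (metis half_gt_zero tendsto_iff)+
    moreover have "\<forall>\<^sub>F w in nhds u. w \<in> S"
      using S by (rule eventually_nhds_in_open)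
    ultimately have "\<forall>\<^sub>F w in nhds u. w \<in> S \<and> dist (f12 w) (f12 u) < e / 2 \<and> dist (f21 w) (f21 u) < e / 2"
      by eventually_elim auto
    then obtain d where d: "d > 0" "\<And>w. dist w u < d \<Longrightarrow>
        w \<in> S \<and> dist (f12 w) (f12 u) < e / 2 \<and> dist (f21 w) (f21 u) < e / 2"
      unfolding eventually_nhds_metric by blast
    \<comment> \<open>The two coordinate offsets then add up to at most 2d/3, so the closed square
      stays within distance \<open>d\<close> of \<open>u\<close>.\<close>
    define h where "h = d / 3"
    have h: "h > 0" using d h_def by auto
    have near: "dist (a, b) u < d" if "x \<le> a" "a \<le> x + h" "y \<le> b" "b \<le> y + h" for a b
    proof -
      have "dist (a, b) u \<le> dist a x + dist b y"
        unfolding u dist_Pair_Pair by (rule order_trans[OF sqrt_sum_squares_le_sum_abs]) auto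
      also have "\<dots> < d" using that d(1) by (auto simp: dist_real_def h_def)
      finally show ?thesis .
    qed
    have "\<exists>z>x. z < x + h \<and> (f (x + h, y + h) - f (x + h, y)) - (f (x, y + h) - f (x, y))
         = (x + h - x) * (f1 (z, y + h) - f1 (z, y))"
      by (rule MVT2) (use h d near in \<open>auto intro!: DERIV_diff along_x f\<close>)
    then obtain z where z: "x < z" "z < x + h" "(f (x + h, y + h) - f (x + h, y)) - (f (x, y + h) - f (x, y))
         = h * (f1 (z, y + h) - f1 (z, y))" by auto
    have "\<exists>c>y. c < y + h \<and> f1 (z, y + h) - f1 (z, y) = (y + h - y) * f12 (z, c)"
      by (rule MVT2) (use h d near z in \<open>auto intro!: along_y f1\<close>)
    then obtain c where c: "y < c" "c < y + h" "f1 (z, y + h) - f1 (z, y) = h * f12 (z, c)" by auto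
    have "\<exists>z>y. z < y + h \<and> (f (x + h, y + h) - f (x, y + h)) - (f (x + h, y) - f (x, y))
         = (y + h - y) * (f2 (x + h, z) - f2 (x, z))"
      by (rule MVT2) (use h d near in \<open>auto intro!: DERIV_diff along_y f\<close>)
    then obtain z' where z': "y < z'" "z' < y + h" "(f (x + h, y + h) - f (x, y + h)) - (f (x + h, y) - f (x, y))
         = h * (f2 (x + h, z') - f2 (x, z'))" by auto
    have "\<exists>c>x. c < x + h \<and> f2 (x + h, z') - f2 (x, z') = (x + h - x) * f21 (c, z')"
      by (rule MVT2) (use h d near z' in \<open>auto intro!: along_x f2\<close>)
    then obtain c' where c': "x < c'" "c' < x + h" "f2 (x + h, z') - f2 (x, z') = h * f21 (c', z')" by auto
    have "h * (h * f12 (z, c)) = h * (h * f21 (c', z'))"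
      using z(3) c(3) z'(3) c'(3) by (simp add: algebra_simps)
    then have "f12 (z, c) = f21 (c', z')" using h by auto
    moreover have "dist (f12 (z, c)) (f12 u) < e / 2" "dist (f21 (c', z')) (f21 u) < e / 2"
      using d(2)[OF near[of z c]] d(2)[OF near[of c' z']] z c z' c' by auto
    ultimately show ?thesis unfolding dist_real_def by linarith
  qed
  then show ?thesis by (metis abs_le_zero_iff dense_ge eq_iff_diff_eq_0)
qed

section \<open>Geometry of graphs in the Heisenberg group\<close>

text \<open>The left-invariant 1-form dz + (y dx - x dy)/2. With dx and dy it is an orthonormal
  coframe, so its value on \<open>v\<close> is the third component of \<open>v\<close> in the
  left-invariant frame.\<close>

definition contact_form :: "h3 \<Rightarrow> h3 \<Rightarrow> real" where
  "contact_form P v = fst (snd P) * fst v / 2 - fst P * fst (snd v) / 2 + snd (snd v)"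

lemma heis_metric_eq:
  "heis_metric P u v = fst u * fst v + fst (snd u) * fst (snd v) + contact_form P u * contact_form P v"
  by (cases P; cases u; cases v) (simp add: contact_form_def)

lemma has_derivative_contact_form:
  "((\<lambda>Q. contact_form Q v) has_derivative (\<lambda>a. (fst (snd a) * fst v - fst a * fst (snd v)) / 2)) (at P)"
  unfolding contact_form_def
  by (rule has_derivative_eq_rhs, (rule derivative_intros | simp)+, intro ext, simp add: field_simps)

lemma frechet_derivative_heis_metric:
  "frechet_derivative (\<lambda>Q. heis_metric Q v w) (at P) a =
     (fst (snd a) * fst v - fst a * fst (snd v)) / 2 * contact_form P w +
     (fst (snd a) * fst w - fst a * fst (snd w)) / 2 * contact_form P v"
proof -
  have "((\<lambda>Q. heis_metric Q v w) has_derivative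
     (\<lambda>a. (fst (snd a) * fst v - fst a * fst (snd v)) / 2 * contact_form P w +
          (fst (snd a) * fst w - fst a * fst (snd w)) / 2 * contact_form P v)) (at P)"
    unfolding heis_metric_eq
    by (rule has_derivative_eq_rhs, (rule has_derivative_add has_derivative_mult has_derivative_const
          has_derivative_contact_form)+, intro ext, simp add: algebra_simps)
  from fun_cong[OF frechet_derivative_at[OF this], of a] show ?thesis
    by (rule sym)
qed

lemma heis_metric_nondegenerate:
  assumes "\<And>a. heis_metric P c a = heis_metric P d a"
  shows "c = d"
proof -
  have "contact_form P c = contact_form P d"
    using assms[of "(0, 0, 1)"] by (simp add: heis_metric_eq contact_form_def)
  moreover from this have "fst c = fst d" "fst (snd c) = fst (snd d)"
    using assms[of "(1, 0, 0)"] assms[of "(0, 1, 0)"] by (simp_all add: heis_metric_eq)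
  ultimately show ?thesis
    by (simp add: contact_form_def prod_eq_iff)
qed

text \<open>The Christoffel vector is horizontal: its last coordinate is exactly the one for which
  the contact form vanishes. Koszul's formula then fixes \<open>k1\<close> and \<open>k2\<close>,
  and nondegeneracy of the metric gives the uniqueness behind the \<open>THE\<close>.\<close>

lemma heis_christoffel_eq:
  defines "k1 \<equiv> \<lambda>P v w. (contact_form P w * fst (snd v) + contact_form P v * fst (snd w)) / 2"
    and "k2 \<equiv> \<lambda>P v w. - (contact_form P w * fst v + contact_form P v * fst w) / 2"
  shows "heis_christoffel P v w = (k1 P v w, k2 P v w, fst P * k2 P v w / 2 - fst (snd P) * k1 P v w / 2)"
  unfolding heis_christoffel_def
proof (rule the_equality)
  show *: "\<forall>a. heis_metric P (k1 P v w, k2 P v w, fst P * k2 P v w / 2 - fst (snd P) * k1 P v w / 2) a =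
     (frechet_derivative (\<lambda>q. heis_metric q w a) (at P) v
      + frechet_derivative (\<lambda>q. heis_metric q v a) (at P) w
      - frechet_derivative (\<lambda>q. heis_metric q v w) (at P) a) / 2"
    unfolding frechet_derivative_heis_metric
    by (simp add: heis_metric_eq contact_form_def k1_def k2_def field_simps)
  show "c = (k1 P v w, k2 P v w, fst P * k2 P v w / 2 - fst (snd P) * k1 P v w / 2)"
    if "\<forall>a. heis_metric P c a =
     (frechet_derivative (\<lambda>q. heis_metric q w a) (at P) v
      + frechet_derivative (\<lambda>q. heis_metric q v a) (at P) w
      - frechet_derivative (\<lambda>q. heis_metric q v w) (at P) a) / 2" for c
    by (rule heis_metric_nondegenerate, rule trans[OF that[rule_format] *[rule_format, symmetric]])
qed

text \<open>The differential of a left translation at the identity sends the coordinate basis to the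
  left-invariant frame, so its inverse reads off frame components.\<close>

lemma gauss_map_eq:
  "gauss_map \<eta> P = (fst (\<eta> P), fst (snd (\<eta> P)), contact_form P (\<eta> P))"
proof -
  have mult: "heis_mult P = (\<lambda>Q. (fst P + fst Q, fst (snd P) + fst (snd Q),
      snd (snd P) + snd (snd Q) + (fst P * fst (snd Q) - fst Q * fst (snd P)) / 2))"
    by (rule ext) (cases P, auto)
  have "(heis_mult P has_derivative
      (\<lambda>v. (fst v, fst (snd v), snd (snd v) + (fst P * fst (snd v) - fst (snd P) * fst v) / 2))) (at 0)"
    unfolding mult
    by (rule has_derivative_eq_rhs, (rule derivative_intros | simp)+, intro ext, simp add: field_simps)
  then have D: "frechet_derivative (heis_mult P) (at 0) =
      (\<lambda>v. (fst v, fst (snd v), snd (snd v) + (fst P * fst (snd v) - fst (snd P) * fst v) / 2))"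
    by (rule frechet_derivative_at[symmetric])
  show ?thesis
    unfolding gauss_map_def D
    by (rule inv_f_eq) (auto simp: inj_def prod_eq_iff contact_form_def field_simps)
qed

text \<open>The partial derivatives are named functions rather than
  \<open>frechet_derivative\<close> terms, so that the explicit models and an arbitrary smooth
  \<open>f\<close> share the computations. The same \<open>s\<close> in both gradients encodes the
  symmetry of the Hessian.\<close>

locale graph_jet =
  fixes \<Omega> :: "(real \<times> real) set" and f f1 f2 r s t :: "real \<times> real \<Rightarrow> real"
  assumes open_domain: "open \<Omega>"
    and deriv_f: "\<And>u. u \<in> \<Omega> \<Longrightarrow> (f has_derivative (\<lambda>h. f1 u * fst h + f2 u * snd h)) (at u)"
    and deriv_f1: "\<And>u. u \<in> \<Omega> \<Longrightarrow> (f1 has_derivative (\<lambda>h. r u * fst h + s u * snd h)) (at u)"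
    and deriv_f2: "\<And>u. u \<in> \<Omega> \<Longrightarrow> (f2 has_derivative (\<lambda>h. s u * fst h + t u * snd h)) (at u)"
begin

definition "p u = f1 u + snd u / 2"
definition "q u = f2 u - fst u / 2"

lemma deriv_p: "u \<in> \<Omega> \<Longrightarrow> (p has_derivative (\<lambda>h. r u * fst h + (s u + 1 / 2) * snd h)) (at u)"
  unfolding p_def[abs_def]
  by (rule derivative_eq_intros deriv_f1 refl | assumption)+ (auto simp: algebra_simps)

lemma deriv_q: "u \<in> \<Omega> \<Longrightarrow> (q has_derivative (\<lambda>h. (s u - 1 / 2) * fst h + t u * snd h)) (at u)"
  unfolding q_def[abs_def]
  by (rule derivative_eq_intros deriv_f2 refl | assumption)+ (auto simp: algebra_simps)

lemma graph_param_eq: "graph_param f = (\<lambda>u. (fst u, snd u, f u))"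
  by (auto simp: graph_param_def)

lemma frechet_derivative_graph:
  assumes "u \<in> \<Omega>"
  shows "frechet_derivative (graph_param f) (at u) = (\<lambda>a. (fst a, snd a, f1 u * fst a + f2 u * snd a))"
proof -
  have "(graph_param f has_derivative (\<lambda>a. (fst a, snd a, f1 u * fst a + f2 u * snd a))) (at u)"
    unfolding graph_param_eq using deriv_f[OF assms]
    by (auto intro!: derivative_eq_intros)
  then show ?thesis by (rule frechet_derivative_at[symmetric])
qed

lemma frechet_derivative_graph2:
  assumes "u \<in> \<Omega>"
  shows "frechet_derivative (\<lambda>w. frechet_derivative (graph_param f) (at w) b) (at u) a =
    (0, 0, (r u * fst a + s u * snd a) * fst b + (s u * fst a + t u * snd a) * snd b)"
proof -
  have "((\<lambda>w. (fst b, snd b, f1 w * fst b + f2 w * snd b)) has_derivative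
      (\<lambda>a. (0, 0, (r u * fst a + s u * snd a) * fst b + (s u * fst a + t u * snd a) * snd b))) (at u)"
    using deriv_f1[OF assms] deriv_f2[OF assms] by (auto intro!: derivative_eq_intros)
  then have "((\<lambda>w. frechet_derivative (graph_param f) (at w) b) has_derivative
      (\<lambda>a. (0, 0, (r u * fst a + s u * snd a) * fst b + (s u * fst a + t u * snd a) * snd b))) (at u)"
    by (rule has_derivative_transform_within_open[OF _ open_domain assms])
       (simp add: frechet_derivative_graph)
  from fun_cong[OF frechet_derivative_at[OF this], of a] show ?thesis
    by (rule sym)
qed

lemma contact_form_tangent:
  "contact_form (graph_param f u) (a, b, f1 u * a + f2 u * b) = p u * a + q u * b"
  by (simp add: contact_form_def graph_param_eq p_def q_def algebra_simps)

text \<open>Orthogonality to the two tangent vectors makes the frame components of \<open>n\<close>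
  proportional to (-p, -q, 1); unit length excludes the factor 0, and its sign is left open.\<close>

lemma normal_components:
  assumes "u \<in> \<Omega>" "\<And>a. heis_metric (graph_param f u) n (frechet_derivative (graph_param f) (at u) a) = 0"
    "heis_metric (graph_param f u) n n = 1"
  defines "\<nu> \<equiv> contact_form (graph_param f u) n"
  shows "fst n = - p u * \<nu>" "fst (snd n) = - q u * \<nu>" "\<nu> \<noteq> 0"
proof -
  show 1: "fst n = - p u * \<nu>"
    using assms(2)[of "(1, 0)"] contact_form_tangent[of u 1 0]
    by (simp add: frechet_derivative_graph[OF assms(1)] heis_metric_eq \<nu>_def mult.commute)
  show 2: "fst (snd n) = - q u * \<nu>"
    using assms(2)[of "(0, 1)"] contact_form_tangent[of u 0 1]
    by (simp add: frechet_derivative_graph[OF assms(1)] heis_metric_eq \<nu>_def mult.commute)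
  show "\<nu> \<noteq> 0"
    using assms(3) 1 2 by (auto simp: heis_metric_eq \<nu>_def)
qed

text \<open>The Hessian entries come from the second derivative of the parametrization, the terms
  quadratic in \<open>p\<close> and \<open>q\<close> from the Christoffel symbols.\<close>

lemma second_form_eq:
  assumes "u \<in> \<Omega>" "\<And>a. heis_metric (graph_param f u) (\<eta> (graph_param f u)) (frechet_derivative (graph_param f) (at u) a) = 0"
    "heis_metric (graph_param f u) (\<eta> (graph_param f u)) (\<eta> (graph_param f u)) = 1"
  defines "\<nu> \<equiv> contact_form (graph_param f u) (\<eta> (graph_param f u))"
  shows "second_form (graph_param f) \<eta> u (1, 0) (1, 0) = \<nu> * (r u + p u * q u)"
    "second_form (graph_param f) \<eta> u (1, 0) (0, 1) = \<nu> * (s u - (p u)\<^sup>2 / 2 + (q u)\<^sup>2 / 2)"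
    "second_form (graph_param f) \<eta> u (0, 1) (0, 1) = \<nu> * (t u - p u * q u)"
proof -
  note n = normal_components[OF assms(1-3), folded \<nu>_def]
  have II: "second_form (graph_param f) \<eta> u a b =
      \<nu> * ((r u * fst a + s u * snd a) * fst b + (s u * fst a + t u * snd a) * snd b
        - p u * ((p u * fst b + q u * snd b) * snd a + (p u * fst a + q u * snd a) * snd b) / 2
        + q u * ((p u * fst b + q u * snd b) * fst a + (p u * fst a + q u * snd a) * fst b) / 2)" for a b
  proof -
    have tang: "contact_form (graph_param f u) (frechet_derivative (graph_param f) (at u) c) = p u * fst c + q u * snd c"
        and proj: "fst (frechet_derivative (graph_param f) (at u) c) = fst c"
          "fst (snd (frechet_derivative (graph_param f) (at u) c)) = snd c" for c
      by (simp_all only: frechet_derivative_graph[OF assms(1)] contact_form_tangent fst_conv snd_conv)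
    \<comment> \<open>Horizontality of the Christoffel vector: only the second derivative of
      \<open>f\<close> reaches the third frame component.\<close>
    have cf: "contact_form P ((0, 0, z) + (k, l, fst P * l / 2 - fst (snd P) * k / 2)) = z" for P z k l
      by (simp add: contact_form_def)
    show ?thesis
      unfolding second_form_def heis_metric_eq cov_deriv_def heis_christoffel_eq frechet_derivative_graph2[OF assms(1)]
        tang proj cf n(1,2) \<nu>_def[symmetric]
      by (simp add: n(1,2)) (simp add: field_simps)
  qed
  show "second_form (graph_param f) \<eta> u (1, 0) (1, 0) = \<nu> * (r u + p u * q u)"
    and "second_form (graph_param f) \<eta> u (1, 0) (0, 1) = \<nu> * (s u - (p u)\<^sup>2 / 2 + (q u)\<^sup>2 / 2)"
    and "second_form (graph_param f) \<eta> u (0, 1) (0, 1) = \<nu> * (t u - p u * q u)"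
    unfolding II by (simp_all add: power2_eq_square)
qed

lemma mean_curvature_eq_0_iff:
  assumes "u \<in> \<Omega>" "\<And>a. heis_metric (graph_param f u) (\<eta> (graph_param f u)) (frechet_derivative (graph_param f) (at u) a) = 0"
    "heis_metric (graph_param f u) (\<eta> (graph_param f u)) (\<eta> (graph_param f u)) = 1"
  shows "mean_curvature (graph_param f) \<eta> u = 0 \<longleftrightarrow>
    (1 + (q u)\<^sup>2) * r u - 2 * p u * q u * s u + (1 + (p u)\<^sup>2) * t u = 0"
proof -
  define \<nu> where "\<nu> = contact_form (graph_param f u) (\<eta> (graph_param f u))"
  have \<nu>: "\<nu> \<noteq> 0" using normal_components[OF assms] by (simp add: \<nu>_def)
  note tang = contact_form_tangent[of u 1 0, simplified] contact_form_tangent[of u 0 1, simplified]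
  have EFG: "first_form (graph_param f) u (1, 0) (1, 0) = 1 + (p u)\<^sup>2"
      "first_form (graph_param f) u (1, 0) (0, 1) = p u * q u"
      "first_form (graph_param f) u (0, 1) (0, 1) = 1 + (q u)\<^sup>2"
    by (simp_all add: first_form_def frechet_derivative_graph[OF assms(1)] heis_metric_eq tang power2_eq_square)
  have "(1 + (p u)\<^sup>2) * (1 + (q u)\<^sup>2) - (p u * q u)\<^sup>2 = 1 + (p u)\<^sup>2 + (q u)\<^sup>2"
    by (simp add: algebra_simps power2_eq_square)
  also have "\<dots> > 0" by (simp add: add_pos_nonneg)
  finally have disc: "(1 + (p u)\<^sup>2) * (1 + (q u)\<^sup>2) - (p u * q u)\<^sup>2 \<noteq> 0" by simp
  have "mean_curvature (graph_param f) \<eta> u = 0 \<longleftrightarrow>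
     (1 + (p u)\<^sup>2) * (\<nu> * (t u - p u * q u)) - 2 * (p u * q u) * (\<nu> * (s u - (p u)\<^sup>2 / 2 + (q u)\<^sup>2 / 2)) +
     (1 + (q u)\<^sup>2) * (\<nu> * (r u + p u * q u)) = 0"
    unfolding mean_curvature_def Let_def EFG second_form_eq[of u \<eta>, OF assms] \<nu>_def[symmetric] using disc by simp
  \<comment> \<open>The contributions of the Christoffel symbols cancel in the trace.\<close>
  also have "(1 + (p u)\<^sup>2) * (\<nu> * (t u - p u * q u)) - 2 * (p u * q u) * (\<nu> * (s u - (p u)\<^sup>2 / 2 + (q u)\<^sup>2 / 2)) +
     (1 + (q u)\<^sup>2) * (\<nu> * (r u + p u * q u)) =
     \<nu> * ((1 + (q u)\<^sup>2) * r u - 2 * p u * q u * s u + (1 + (p u)\<^sup>2) * t u)"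
    by (simp add: algebra_simps power2_eq_square)
  finally show ?thesis using \<nu> by simp
qed

lemma minimal_surface_equation:
  assumes "minimal_surface \<Omega> (graph_param f)" "u \<in> \<Omega>"
  shows "(1 + (q u)\<^sup>2) * r u - 2 * p u * q u * s u + (1 + (p u)\<^sup>2) * t u = 0"
proof -
  obtain \<eta> where "oriented_surface \<Omega> (graph_param f) \<eta>" "mean_curvature (graph_param f) \<eta> u = 0"
    using assms unfolding minimal_surface_def by blast
  then show ?thesis
    using mean_curvature_eq_0_iff[OF assms(2), of \<eta>] assms(2) unfolding oriented_surface_def by blast
qed

text \<open>The coordinates \<open>p, q\<close> are recovered from the Gauss map by central projection, so its
  differential is injective wherever that of \<open>(p, q)\<close> is.\<close>

lemma rank_one_equation:
  assumes "gauss_map_rank_one \<Omega> (graph_param f)" "u \<in> \<Omega>"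
  shows "r u * t u - (s u)\<^sup>2 + 1 / 4 = 0"
proof (rule ccontr)
  assume det: "r u * t u - (s u)\<^sup>2 + 1 / 4 \<noteq> 0"
  let ?X = "graph_param f"
  obtain \<eta> D where \<eta>: "oriented_surface \<Omega> ?X \<eta>"
      and D: "((gauss_map \<eta> \<circ> ?X) has_derivative D) (at u)" "dim (range D) = 1"
    using assms unfolding gauss_map_rank_one_def by blast
  define \<nu> where "\<nu> = (\<lambda>w. contact_form (?X w) (\<eta> (?X w)))"
  define G where "G = gauss_map \<eta> \<circ> ?X"
  have G: "G w = (- p w * \<nu> w, - q w * \<nu> w, \<nu> w)" and nz: "\<nu> w \<noteq> 0" if "w \<in> \<Omega>" for w
    using normal_components[OF that, of "\<eta> (?X w)"] \<eta> that
    unfolding oriented_surface_def G_def by (auto simp: gauss_map_eq \<nu>_def)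
  have DG: "(G has_derivative D) (at u)" using D by (simp add: G_def)
  have Gu: "snd (snd (G u)) \<noteq> 0" using G[OF assms(2)] nz[OF assms(2)] by simp
  have "((\<lambda>w. - fst (G w) / snd (snd (G w))) has_derivative
     (\<lambda>h. (- fst (D h) * snd (snd (G u)) + fst (G u) * snd (snd (D h))) / (snd (snd (G u)))\<^sup>2)) (at u)"
    using DG Gu by (auto intro!: derivative_eq_intros ext simp: field_simps power2_eq_square)
  then have "(p has_derivative
     (\<lambda>h. (- fst (D h) * snd (snd (G u)) + fst (G u) * snd (snd (D h))) / (snd (snd (G u)))\<^sup>2)) (at u)"
    by (rule has_derivative_transform_within_open[OF _ open_domain assms(2)]) (simp add: G nz)
  then have p: "(\<lambda>h. (- fst (D h) * snd (snd (G u)) + fst (G u) * snd (snd (D h))) / (snd (snd (G u)))\<^sup>2) =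
     (\<lambda>h. r u * fst h + (s u + 1 / 2) * snd h)"
    using deriv_p[OF assms(2)] has_derivative_unique by blast
  have "((\<lambda>w. - fst (snd (G w)) / snd (snd (G w))) has_derivative
     (\<lambda>h. (- fst (snd (D h)) * snd (snd (G u)) + fst (snd (G u)) * snd (snd (D h))) / (snd (snd (G u)))\<^sup>2)) (at u)"
    using DG Gu by (auto intro!: derivative_eq_intros ext simp: field_simps power2_eq_square)
  then have "(q has_derivative
     (\<lambda>h. (- fst (snd (D h)) * snd (snd (G u)) + fst (snd (G u)) * snd (snd (D h))) / (snd (snd (G u)))\<^sup>2)) (at u)"
    by (rule has_derivative_transform_within_open[OF _ open_domain assms(2)]) (simp add: G nz)
  then have q: "(\<lambda>h. (- fst (snd (D h)) * snd (snd (G u)) + fst (snd (G u)) * snd (snd (D h))) / (snd (snd (G u)))\<^sup>2) =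
     (\<lambda>h. (s u - 1 / 2) * fst h + t u * snd h)"
    using deriv_q[OF assms(2)] has_derivative_unique by blast
  have "h = 0" if "D h = 0" for h
  proof -
    have e1: "r u * fst h + (s u + 1 / 2) * snd h = 0"
      using fun_cong[OF p, of h] that by simp
    have e2: "(s u - 1 / 2) * fst h + t u * snd h = 0"
      using fun_cong[OF q, of h] that by simp
    \<comment> \<open>Cramer's rule for the Jacobian matrix of (p, q), whose determinant is the rank
      one expression.\<close>
    have "(r u * t u - (s u)\<^sup>2 + 1 / 4) * fst h =
        t u * (r u * fst h + (s u + 1 / 2) * snd h) - (s u + 1 / 2) * ((s u - 1 / 2) * fst h + t u * snd h)"
      by (simp add: algebra_simps power2_eq_square)
    moreover have "(r u * t u - (s u)\<^sup>2 + 1 / 4) * snd h =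
        r u * ((s u - 1 / 2) * fst h + t u * snd h) - (s u - 1 / 2) * (r u * fst h + (s u + 1 / 2) * snd h)"
      by (simp add: algebra_simps power2_eq_square)
    ultimately have "(r u * t u - (s u)\<^sup>2 + 1 / 4) * fst h = 0" "(r u * t u - (s u)\<^sup>2 + 1 / 4) * snd h = 0"
      unfolding e1 e2 by simp_all
    then show ?thesis using det by (simp add: prod_eq_iff)
  qed
  moreover have lin: "linear D" using D(1) has_derivative_linear by blast
  ultimately have "inj D" by (simp add: linear_injective_0)
  then have "dim (range D) = dim (UNIV :: (real \<times> real) set)"
    using dim_image_eq[OF lin, of UNIV] by simp
  then show False using D(2) by simp
qed

end

section \<open>The model graphs and the isometries\<close>

definition hyp_profile :: "real \<times> real \<Rightarrow> real" where
  "hyp_profile u = sqrt (1 + (snd u)\<^sup>2)"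

lemma hyp_profile_pos: "hyp_profile u > 0" and hyp_profile_square: "(hyp_profile u)\<^sup>2 = 1 + (snd u)\<^sup>2"
  by (simp_all add: hyp_profile_def add_pos_nonneg)

lemma has_derivative_hyp_profile:
  "(hyp_profile has_derivative (\<lambda>v. snd v * (snd u * inverse (hyp_profile u)))) (at u)"
proof -
  have "((\<lambda>u :: real \<times> real. 1 + (snd u)\<^sup>2) has_derivative (\<lambda>v. 2 * snd u * snd v)) (at u)"
    by (rule has_derivative_eq_rhs, (rule derivative_intros | simp)+) (simp add: fun_eq_iff)
  from has_derivative_real_sqrt[OF _ this] show ?thesis
    by (simp add: hyp_profile_def[abs_def] add_pos_nonneg field_simps)
qed

lemma has_derivative_inverse_hyp_profile:
  "((\<lambda>u. inverse (hyp_profile u)) has_derivative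
     (\<lambda>v. - snd v * (snd u * (inverse (hyp_profile u) * (inverse (hyp_profile u) * inverse (hyp_profile u)))))) (at u)"
  using Deriv.has_derivative_inverse[OF _ has_derivative_hyp_profile, of u] hyp_profile_pos[of u]
  by (simp add: mult_ac)

lemma Ck_on_snd: "Ck_on n UNIV (snd :: real \<times> real \<Rightarrow> real)"
  by (simp add: Ck_on_bounded_linear bounded_linear_snd)

text \<open>The derivative of 1/h is a polynomial in y and 1/h itself, so the induction on the order
  closes. The derivative of h, being y/h, is then covered as well.\<close>

lemma Ck_on_inverse_hyp_profile: "Ck_on n UNIV (\<lambda>u. inverse (hyp_profile u))"
proof (induction n)
  case 0
  show ?case
    using has_derivative_continuous[OF has_derivative_inverse_hyp_profile]
    by (auto intro: continuous_at_imp_continuous_on)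
next
  case (Suc n)
  show ?case
    by (rule Ck_on_SucI[OF _ has_derivative_inverse_hyp_profile])
       (intro open_UNIV Ck_on_mult Ck_on_const Ck_on_snd Suc)+
qed

lemma Ck_on_hyp_profile: "Ck_on n UNIV hyp_profile"
proof -
  have "Ck_on (Suc n) UNIV hyp_profile"
    by (rule Ck_on_SucI[OF _ has_derivative_hyp_profile])
       (intro open_UNIV Ck_on_mult Ck_on_const Ck_on_snd Ck_on_inverse_hyp_profile)+
  then show ?thesis by (rule Ck_on_SucD)
qed

lemma rank_one_fun_primitive:
  "((\<lambda>y. y * sqrt (1 + y\<^sup>2) + ln (y + sqrt (1 + y\<^sup>2))) has_real_derivative 2 * sqrt (1 + y\<^sup>2)) (at y)"
proof -
  have sq: "1 + y\<^sup>2 > 0" by (simp add: add_pos_nonneg)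
  \<comment> \<open>Keeps the argument of the logarithm positive for negative \<open>y\<close>
    too.\<close>
  have "\<bar>y\<bar> < sqrt (1 + y\<^sup>2)" by (rule real_less_rsqrt) simp
  then have pos: "y + sqrt (1 + y\<^sup>2) > 0" by linarith
  have root: "((\<lambda>y. sqrt (1 + y\<^sup>2)) has_real_derivative y / sqrt (1 + y\<^sup>2)) (at y)"
    using sq by (auto intro!: derivative_eq_intros simp: field_simps)
  have deriv: "((\<lambda>y. y * sqrt (1 + y\<^sup>2) + ln (y + sqrt (1 + y\<^sup>2))) has_real_derivative
      1 * sqrt (1 + y\<^sup>2) + (y / sqrt (1 + y\<^sup>2)) * y + (1 + y / sqrt (1 + y\<^sup>2)) / (y + sqrt (1 + y\<^sup>2))) (at y)"
    using DERIV_add[OF DERIV_mult[OF DERIV_ident root]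
        DERIV_chain2[OF DERIV_ln_divide[OF pos] DERIV_add[OF DERIV_ident root]]]
    by (simp add: mult.commute)
  have e1: "(1 + y / sqrt (1 + y\<^sup>2)) / (y + sqrt (1 + y\<^sup>2)) = 1 / sqrt (1 + y\<^sup>2)"
  proof -
    have "1 + y / sqrt (1 + y\<^sup>2) = (y + sqrt (1 + y\<^sup>2)) / sqrt (1 + y\<^sup>2)"
      unfolding add_divide_distrib using sq by simp
    then show ?thesis using pos by simp
  qed
  have e2: "(y / sqrt (1 + y\<^sup>2)) * y + 1 / sqrt (1 + y\<^sup>2) = sqrt (1 + y\<^sup>2)"
    using sq by (simp add: field_simps power2_eq_square)
  show ?thesis
    by (rule DERIV_cong[OF deriv]) (use e1 e2 in linarith)
qed

lemma has_derivative_rank_one_fun: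
  "(rank_one_fun k has_derivative (\<lambda>v. snd u / 2 * fst v + (fst u / 2 - k * hyp_profile u) * snd v)) (at u)"
proof -
  have "((\<lambda>u. snd u * sqrt (1 + (snd u)\<^sup>2) + ln (snd u + sqrt (1 + (snd u)\<^sup>2))) has_derivative
      (\<lambda>v. 2 * sqrt (1 + (snd u)\<^sup>2) * snd v)) (at u)"
    using has_derivative_compose[OF has_derivative_snd[OF has_derivative_ident]
        rank_one_fun_primitive[of "snd u", unfolded has_field_derivative_def]] by simp
  then have "((\<lambda>u. fst u * snd u / 2 - k / 2 * (snd u * sqrt (1 + (snd u)\<^sup>2) + ln (snd u + sqrt (1 + (snd u)\<^sup>2))))
      has_derivative (\<lambda>v. (fst u * snd v + fst v * snd u) / 2 - k / 2 * (2 * sqrt (1 + (snd u)\<^sup>2) * snd v))) (at u)"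
    by (intro derivative_intros bounded_linear.has_derivative[OF bounded_linear_divide])
  then show ?thesis
    unfolding rank_one_fun_def case_prod_beta hyp_profile_def
    by (rule has_derivative_eq_rhs) (simp add: fun_eq_iff field_simps)
qed

lemma smooth_on_rank_one_fun: "smooth_on UNIV (rank_one_fun k)"
  unfolding smooth_on_def
proof
  fix n
  have "Ck_on (Suc n) UNIV (rank_one_fun k)"
  proof (rule Ck_on_SucI[OF _ has_derivative_rank_one_fun])
    show "Ck_on n UNIV (\<lambda>u. snd u / 2 * fst v + (fst u / 2 - k * hyp_profile u) * snd v)" for v
    proof -
      have "(\<lambda>u. snd u / 2 * fst v + (fst u / 2 - k * hyp_profile u) * snd v) =
          (\<lambda>u. (snd u * (fst v / 2) + fst u * (snd v / 2)) + (- k * snd v) * hyp_profile u)"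
        by (simp add: fun_eq_iff algebra_simps)
      moreover have "Ck_on n UNIV (\<lambda>u. (snd u * (fst v / 2) + fst u * (snd v / 2)) + (- k * snd v) * hyp_profile u)"
        by (intro open_UNIV Ck_on_add Ck_on_mult Ck_on_const Ck_on_hyp_profile Ck_on_bounded_linear
            bounded_linear_fst bounded_linear_snd)
      ultimately show ?thesis by simp
    qed
  qed auto
  then show "Ck_on n UNIV (rank_one_fun k)" by (rule Ck_on_SucD)
qed

lemma smooth_on_graph_param:
  assumes "open S" "smooth_on S f"
  shows "smooth_on S (graph_param f)"
proof -
  have "graph_param f = (\<lambda>u. (fst u, snd u, f u))" by (auto simp: graph_param_def)
  then show ?thesis
    using assms unfolding smooth_on_def
    by (simp add: Ck_on_Pair Ck_on_bounded_linear bounded_linear_fst bounded_linear_snd)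
qed

text \<open>Here r = 0 and s = 1/2, so the first column (r, s - 1/2) of the Jacobian matrix of (p,
  q) vanishes: the kernel is the x-direction everywhere.\<close>

interpretation rank_one_jet: graph_jet UNIV "rank_one_fun k" "\<lambda>u. snd u / 2" "\<lambda>u. fst u / 2 - k * hyp_profile u"
  "\<lambda>_. 0" "\<lambda>_. 1 / 2" "\<lambda>u. - k * (snd u * inverse (hyp_profile u))" for k
proof
  show "(rank_one_fun k has_derivative (\<lambda>h. snd u / 2 * fst h + (fst u / 2 - k * hyp_profile u) * snd h)) (at u)" for u
    by (rule has_derivative_rank_one_fun)
  show "((\<lambda>u. snd u / 2) has_derivative (\<lambda>h. 0 * fst h + 1 / 2 * snd h)) (at u)" for u :: "real \<times> real"
    by (rule has_derivative_eq_rhs, (rule derivative_intros | simp)+)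
  show "((\<lambda>u. fst u / 2 - k * hyp_profile u) has_derivative
      (\<lambda>h. 1 / 2 * fst h + - k * (snd u * inverse (hyp_profile u)) * snd h)) (at u)" for u
  proof -
    have "((\<lambda>u. fst u / 2 - k * hyp_profile u) has_derivative
      (\<lambda>h. fst h / 2 - k * (snd h * (snd u * inverse (hyp_profile u))))) (at u)"
      by (intro derivative_intros has_derivative_hyp_profile bounded_linear.has_derivative[OF bounded_linear_divide])
    then show ?thesis by (rule has_derivative_eq_rhs) (simp add: fun_eq_iff algebra_simps)
  qed
qed simp

section \<open>The model graphs are minimal with Gauss map of rank one\<close>

lemma rank_one_jet_pq: "rank_one_jet.p u = snd u" "rank_one_jet.q k u = - (k * hyp_profile u)"
  by (simp_all add: rank_one_jet.p_def rank_one_jet.q_def)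

text \<open>The frame components are (-p, -q, 1) times \<open>\<nu>\<close>, with p = y and q = -k
  h. As 1 + p^2 + q^2 = (1 + k^2) h^2, this \<open>\<nu>\<close> gives unit length. The extra terms
  in the last entry convert frame components to coordinates.\<close>

definition rank_one_normal :: "real \<Rightarrow> h3 \<Rightarrow> h3" where
  "rank_one_normal k P = (let y = fst (snd P); h = sqrt (1 + y\<^sup>2); \<nu> = 1 / (sqrt (1 + k\<^sup>2) * h)
     in (- y * \<nu>, k * h * \<nu>, \<nu> + y * y * \<nu> / 2 + fst P * (k * h * \<nu>) / 2))"

lemma rank_one_normal_graph:
  defines "\<nu> \<equiv> \<lambda>k u. 1 / (sqrt (1 + k\<^sup>2) * hyp_profile u)"
  shows "fst (rank_one_normal k (graph_param g u)) = - snd u * \<nu> k u"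
    "fst (snd (rank_one_normal k (graph_param g u))) = k * hyp_profile u * \<nu> k u"
    "contact_form (graph_param g u) (rank_one_normal k (graph_param g u)) = \<nu> k u"
  by (cases u; simp add: rank_one_normal_def graph_param_def Let_def \<nu>_def hyp_profile_def contact_form_def)+

lemma oriented_surface_rank_one:
  "oriented_surface UNIV (graph_param (rank_one_fun k)) (rank_one_normal k)"
proof -
  let ?X = "graph_param (rank_one_fun k)"
  have K: "(sqrt (1 + k\<^sup>2))\<^sup>2 = 1 + k\<^sup>2" "sqrt (1 + k\<^sup>2) > 0" by (simp_all add: add_pos_nonneg)
  have norm: "heis_metric (?X u) (rank_one_normal k (?X u)) (rank_one_normal k (?X u)) = 1" for u
  proof -
    have "(snd u)\<^sup>2 + (k * hyp_profile u)\<^sup>2 + 1 = (sqrt (1 + k\<^sup>2) * hyp_profile u)\<^sup>2"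
      using K by (simp add: power_mult_distrib hyp_profile_square distrib_right distrib_left)
    then have "((snd u)\<^sup>2 + (k * hyp_profile u)\<^sup>2 + 1) * (1 / (sqrt (1 + k\<^sup>2) * hyp_profile u))\<^sup>2 = 1"
      using K(2) hyp_profile_pos[of u] by (simp add: power_one_over)
    then show ?thesis
      unfolding heis_metric_eq rank_one_normal_graph by (simp only: power2_eq_square) argo
  qed
  have orth: "heis_metric (?X u) (rank_one_normal k (?X u)) (frechet_derivative ?X (at u) a) = 0" for u a
    unfolding heis_metric_eq rank_one_jet.frechet_derivative_graph[OF UNIV_I] rank_one_jet.contact_form_tangent
      rank_one_normal_graph rank_one_jet_pq fst_conv snd_conv by argo
  have "continuous_on UNIV (rank_one_normal k)"
    unfolding rank_one_normal_def[abs_def] Let_def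
    by (intro continuous_intros) (use K in \<open>auto simp: add_pos_nonneg add_nonneg_eq_0_iff\<close>)
  then have "continuous_on (range ?X) (rank_one_normal k)"
    by (rule continuous_on_subset) simp
  moreover have "inj ?X"
    by (auto simp: inj_def graph_param_def)
  moreover have "inj (frechet_derivative ?X (at u))" for u
    unfolding rank_one_jet.frechet_derivative_graph[OF UNIV_I] by (auto simp: inj_def prod_eq_iff)
  ultimately show ?thesis
    unfolding oriented_surface_def
    using norm orth smooth_on_graph_param[OF open_UNIV smooth_on_rank_one_fun] by blast
qed

lemma minimal_surface_rank_one: "minimal_surface UNIV (graph_param (rank_one_fun k))"
proof -
  have "mean_curvature (graph_param (rank_one_fun k)) (rank_one_normal k) u = 0" for u
  proof (subst rank_one_jet.mean_curvature_eq_0_iff)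
    \<comment> \<open>With r = 0 and s = 1/2 the minimal surface equation reduces to (1 + y^2)/h =
      h, multiplied by k y.\<close>
    have "inverse (hyp_profile u) * (hyp_profile u)\<^sup>2 = hyp_profile u"
      using hyp_profile_pos[of u] by (simp add: power2_eq_square)
    then have "(1 + (snd u)\<^sup>2) * inverse (hyp_profile u) = hyp_profile u"
      by (simp add: hyp_profile_square mult.commute)
    then have eq1: "(1 + (snd u)\<^sup>2) * (k * (snd u * inverse (hyp_profile u))) = snd u * (k * hyp_profile u)"
      by (metis mult.left_commute)
    have eq2: "(1 + (rank_one_jet.q k u)\<^sup>2) * 0 - 2 * rank_one_jet.p u * rank_one_jet.q k u * (1 / 2) +
        (1 + (rank_one_jet.p u)\<^sup>2) * (- k * (snd u * inverse (hyp_profile u))) =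
        snd u * (k * hyp_profile u) - (1 + (snd u)\<^sup>2) * (k * (snd u * inverse (hyp_profile u)))"
      by (simp add: rank_one_jet_pq)
    show "(1 + (rank_one_jet.q k u)\<^sup>2) * 0 - 2 * rank_one_jet.p u * rank_one_jet.q k u * (1 / 2) +
        (1 + (rank_one_jet.p u)\<^sup>2) * (- k * (snd u * inverse (hyp_profile u))) = 0"
      by (rule trans[OF eq2]) (simp only: eq1 diff_self)
  qed (use oriented_surface_rank_one[of k] in \<open>simp_all only: oriented_surface_def UNIV_I ball_UNIV\<close>)
  then show ?thesis
    unfolding minimal_surface_def using oriented_surface_rank_one by blast
qed

text \<open>The second frame component of the normal is the constant k / sqrt(1 + k^2) and the
  others depend on y alone. So the Gauss image lies on a circle and the differential factors through
  dy.\<close>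

lemma gauss_map_rank_one_rank_one: "gauss_map_rank_one UNIV (graph_param (rank_one_fun k))"
  unfolding gauss_map_rank_one_def
proof (intro exI[of _ "rank_one_normal k"] conjI ballI oriented_surface_rank_one)
  fix u :: "real \<times> real"
  define K where "K = sqrt (1 + k\<^sup>2)"
  have K: "K > 0" by (simp add: K_def add_pos_nonneg)
  have nz: "hyp_profile w \<noteq> 0" for w using hyp_profile_pos[of w] by simp
  let ?h = "\<lambda>u. inverse (hyp_profile u)"
  have G: "gauss_map (rank_one_normal k) \<circ> graph_param (rank_one_fun k) =
      (\<lambda>u. (- snd u * ?h u / K, k / K, ?h u / K))"
    using nz K by (auto simp: fun_eq_iff gauss_map_eq rank_one_normal_graph K_def[symmetric] field_simps)
  define v where "v = (- (?h u - snd u * (snd u * (?h u * (?h u * ?h u)))) / K, 0 :: real, - (snd u * (?h u * (?h u * ?h u))) / K)"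
  define D where "D = (\<lambda>a :: real \<times> real. snd a *\<^sub>R v)"
  have "((\<lambda>u. (- snd u * ?h u / K, k / K, ?h u / K)) has_derivative
     (\<lambda>a. ((- snd u * (- snd a * (snd u * (?h u * (?h u * ?h u)))) + - snd a * ?h u) / K, 0,
       (- snd a * (snd u * (?h u * (?h u * ?h u)))) / K))) (at u)"
    using K by (intro has_derivative_Pair has_derivative_const bounded_linear.has_derivative[OF bounded_linear_divide]
        has_derivative_mult has_derivative_minus has_derivative_snd has_derivative_ident has_derivative_inverse_hyp_profile)
  then have "(gauss_map (rank_one_normal k) \<circ> graph_param (rank_one_fun k) has_derivative D) (at u)"
    unfolding G by (rule has_derivative_eq_rhs) (simp add: fun_eq_iff D_def v_def algebra_simps)
  \<comment> \<open>If the last component vanishes then y = 0, and the first component is then -1/(K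
    h).\<close>
  moreover have "v \<noteq> 0"
    using K hyp_profile_pos[of u] by (auto simp: v_def prod_eq_iff less_imp_neq)
  then have "dim (span {v}) = 1" unfolding dim_span by simp
  moreover have "range D = span {v}"
    by (auto simp: D_def span_singleton image_def)
  ultimately show "\<exists>D. (gauss_map (rank_one_normal k) \<circ> graph_param (rank_one_fun k) has_derivative D) (at u) \<and> dim (range D) = 1"
    by auto
qed

text \<open>A rotation about the \<open>z\<close>-axis followed by the left translation by \<open>(0, b, e)\<close>.\<close>

definition heis_motion :: "real \<Rightarrow> real \<Rightarrow> real \<Rightarrow> real \<Rightarrow> h3 \<Rightarrow> h3" where
  "heis_motion c d b e P = (c * fst P + d * fst (snd P), - d * fst P + c * fst (snd P) + b,
     snd (snd P) + e - b * (c * fst P + d * fst (snd P)) / 2)"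

section \<open>Motions of the Heisenberg group and their action on graphs\<close>

lemma smooth_on_affine:
  fixes L :: "'a::euclidean_space \<Rightarrow> 'b::euclidean_space"
  assumes "linear L"
  shows "smooth_on UNIV (\<lambda>x. L x + a)"
  unfolding smooth_on_def
  using assms by (simp add: Ck_on_add Ck_on_bounded_linear Ck_on_const linear_conv_bounded_linear)

text \<open>The motion is affine with linear part \<open>L\<close>, so its derivative is
  \<open>L\<close> at every point. \<open>L\<close> rotates the horizontal components and carries
  the contact form at \<open>P\<close> to that at the image of \<open>P\<close>, hence preserves
  both parts of the metric.\<close>

lemma heis_isometry_motion:
  assumes cd: "c\<^sup>2 + d\<^sup>2 = 1"
  shows "heis_isometry (heis_motion c d b e)"
proof -
  define L where "L = (\<lambda>P :: h3. (c * fst P + d * fst (snd P), - d * fst P + c * fst (snd P),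
     snd (snd P) - b * (c * fst P + d * fst (snd P)) / 2))"
  define M where "M = (\<lambda>P :: h3. (c * fst P - d * fst (snd P), d * fst P + c * fst (snd P),
     snd (snd P) + b * fst P / 2))"
  let ?m = "heis_motion c d b e"
  have L: "linear L" and M: "linear M"
    unfolding L_def M_def by (rule linearI; simp add: algebra_simps add_divide_distrib)+
  have m: "?m = (\<lambda>P. L P + (0, b, e))"
    by (simp add: heis_motion_def L_def fun_eq_iff)
  have right_inv: "L (M P) = P" for P
  proof -
    have "L (M P) = ((c\<^sup>2 + d\<^sup>2) * fst P, (c\<^sup>2 + d\<^sup>2) * fst (snd P),
        snd (snd P) + b * (1 - (c\<^sup>2 + d\<^sup>2)) * fst P / 2)"
      by (simp add: L_def M_def field_simps power2_eq_square)
    then show ?thesis by (simp add: cd)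
  qed
  have left_inv: "M (L P) = P" for P
  proof -
    have "M (L P) = ((c\<^sup>2 + d\<^sup>2) * fst P, (c\<^sup>2 + d\<^sup>2) * fst (snd P),
        snd (snd P))"
      by (simp add: L_def M_def field_simps power2_eq_square)
    then show ?thesis by (simp add: cd)
  qed
  have inv: "inv ?m = (\<lambda>P. M P + - M (0, b, e))"
  proof (rule inv_equality)
    show "M (?m P) + - M (0, b, e) = P" for P
      using left_inv[of P] linear_add[OF M] by (simp add: m)
    show "?m (M P + - M (0, b, e)) = P" for P
      using right_inv linear_diff[OF L] by (simp add: m)
  qed
  have "bij ?m"
    by (rule o_bij[of "\<lambda>P. M P + - M (0, b, e)"])
       (use left_inv right_inv linear_add[OF M] linear_diff[OF L] in \<open>auto simp: m fun_eq_iff\<close>)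
  moreover have "smooth_on UNIV ?m" "smooth_on UNIV (inv ?m)"
    unfolding m inv[unfolded m] by (intro smooth_on_affine L M)+
  moreover have D: "frechet_derivative ?m (at P) = L" for P
  proof -
    have "((\<lambda>P. L P + (0, b, e)) has_derivative (\<lambda>v. L v + 0)) (at P)"
      by (intro has_derivative_add has_derivative_const linear_imp_has_derivative L)
    then show ?thesis unfolding m by (simp add: frechet_derivative_at[symmetric])
  qed
  moreover have "heis_metric (?m P) (L u) (L v) = heis_metric P u v" for P u v
  proof -
    have contact: "contact_form (?m P) (L w) = contact_form P w" for w
    proof -
      have "contact_form (?m P) (L w) =
          (c\<^sup>2 + d\<^sup>2) * (fst (snd P) * fst w / 2 - fst P * fst (snd w) / 2) + snd (snd w)"
        by (simp add: contact_form_def heis_motion_def L_def field_simps power2_eq_square)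
      then show ?thesis by (simp add: cd contact_form_def)
    qed
    have "fst (L u) * fst (L v) + fst (snd (L u)) * fst (snd (L v)) =
        (c\<^sup>2 + d\<^sup>2) * (fst u * fst v + fst (snd u) * fst (snd v))"
      by (simp add: L_def algebra_simps power2_eq_square)
    then show ?thesis by (simp add: heis_metric_eq contact cd)
  qed
  ultimately show ?thesis by (simp add: heis_isometry_def)
qed

lemma openin_motion_graph:
  assumes "open \<Omega>" and cd: "c\<^sup>2 + d\<^sup>2 = 1"
    and f: "\<And>u. u \<in> \<Omega> \<Longrightarrow> f u + e - b * (c * fst u + d * snd u) / 2 =
      g (c * fst u + d * snd u, - d * fst u + c * snd u + b)"
  shows "openin (top_of_set (graph_on UNIV g)) (heis_motion c d b e ` graph_on \<Omega> f)"
proof -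
  \<comment> \<open>\<open>\<psi>\<close> is the planar motion covered by the isometry and
    \<open>\<xi>\<close> its inverse.\<close>
  define \<psi> where "\<psi> = (\<lambda>u. (c * fst u + d * snd u, - d * fst u + c * snd u + b))"
  define \<xi> where "\<xi> = (\<lambda>w. (c * fst w - d * (snd w - b), d * fst w + c * (snd w - b)))"
  have 1: "\<xi> (\<psi> u) = u" for u
  proof -
    have "\<xi> (\<psi> u) = ((c\<^sup>2 + d\<^sup>2) * fst u, (c\<^sup>2 + d\<^sup>2) * snd u)"
      by (simp add: \<psi>_def \<xi>_def algebra_simps power2_eq_square)
    then show ?thesis by (simp add: cd)
  qed
  have 2: "\<psi> (\<xi> w) = w" for w
  proof -
    have "\<psi> (\<xi> w) = ((c\<^sup>2 + d\<^sup>2) * fst w, (c\<^sup>2 + d\<^sup>2) * (snd w - b) + b)"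
      by (simp add: \<psi>_def \<xi>_def algebra_simps power2_eq_square)
    then show ?thesis by (simp add: cd)
  qed
  have motion: "heis_motion c d b e (graph_param f u) = graph_param g (\<psi> u)" if "u \<in> \<Omega>" for u
    using f[OF that] by (cases u) (simp add: heis_motion_def graph_param_def \<psi>_def)
  \<comment> \<open>The open cylinder over the image of \<open>\<Omega>\<close> under
    \<open>\<psi>\<close>; it cuts the moved graph out of the graph of \<open>g\<close>.\<close>
  define T where "T = (\<lambda>P :: h3. \<xi> (fst P, fst (snd P))) -` \<Omega>"
  have "open T"
    unfolding T_def \<xi>_def by (intro open_vimage assms continuous_intros)
  moreover have "heis_motion c d b e ` graph_on \<Omega> f = graph_on UNIV g \<inter> T"
  proof (intro equalityI subsetI)
    fix P assume "P \<in> heis_motion c d b e ` graph_on \<Omega> f"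
    then obtain u where "u \<in> \<Omega>" "P = graph_param g (\<psi> u)"
      using motion by (auto simp: graph_on_def)
    then show "P \<in> graph_on UNIV g \<inter> T"
      by (cases "\<psi> u") (use 1[of u] in \<open>auto simp: graph_on_def T_def graph_param_def\<close>)
  next
    fix P assume "P \<in> graph_on UNIV g \<inter> T"
    then obtain w where w: "P = graph_param g w" "\<xi> w \<in> \<Omega>"
      by (auto simp: graph_on_def T_def graph_param_def)
    then have "P = heis_motion c d b e (graph_param f (\<xi> w))"
      using motion[of "\<xi> w"] 2 by simp
    then show "P \<in> heis_motion c d b e ` graph_on \<Omega> f"
      using w by (auto simp: graph_on_def)
  qed
  ultimately show ?thesis by (auto simp: openin_open)
qed

section \<open>Constancy of the kernel direction\<close>

lemma smooth_on_partials:
  fixes g :: "real \<times> real \<Rightarrow> real"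
  assumes "smooth_on S g" "u \<in> S"
  shows "(g has_derivative (\<lambda>h. frechet_derivative g (at u) (1, 0) * fst h + frechet_derivative g (at u) (0, 1) * snd h)) (at u)"
proof -
  have D: "(g has_derivative frechet_derivative g (at u)) (at u)"
    by (rule smooth_on_has_derivative[OF assms])
  then have lin: "linear (frechet_derivative g (at u))"
    by (rule has_derivative_linear)
  have "frechet_derivative g (at u) h =
      frechet_derivative g (at u) (1, 0) * fst h + frechet_derivative g (at u) (0, 1) * snd h" for h
  proof -
    have "h = fst h *\<^sub>R (1, 0) + snd h *\<^sub>R (0, 1)" by (simp add: prod_eq_iff)
    then have "frechet_derivative g (at u) h = frechet_derivative g (at u) (fst h *\<^sub>R (1, 0) + snd h *\<^sub>R (0, 1))"
      by (rule arg_cong)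
    also have "\<dots> = fst h *\<^sub>R frechet_derivative g (at u) (1, 0) + snd h *\<^sub>R frechet_derivative g (at u) (0, 1)"
      by (simp only: linear_add[OF lin] linear_cmul[OF lin])
    finally show ?thesis by (simp add: mult.commute)
  qed
  then have "frechet_derivative g (at u) =
      (\<lambda>h. frechet_derivative g (at u) (1, 0) * fst h + frechet_derivative g (at u) (0, 1) * snd h)"
    by (rule ext)
  with D show ?thesis by metis
qed

lemma smooth_on_mixed_partials:
  fixes g :: "real \<times> real \<Rightarrow> real"
  assumes "open S" "smooth_on S g" "u \<in> S"
  shows "frechet_derivative (\<lambda>w. frechet_derivative g (at w) (1, 0)) (at u) (0, 1) =
    frechet_derivative (\<lambda>w. frechet_derivative g (at w) (0, 1)) (at u) (1, 0)"
  by (rule mixed_partials_eq[OF assms(1,3) smooth_on_partials[OF assms(2)]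
        smooth_on_partials[OF smooth_on_frechet_derivative[OF assms(2)]]
        smooth_on_partials[OF smooth_on_frechet_derivative[OF assms(2)]]])
     (assumption | intro smooth_on_continuous_on smooth_on_frechet_derivative assms(2))+

text \<open>Sharing \<open>T1\<close> and \<open>T2\<close> between consecutive gradients encodes
  the symmetry of the third derivatives.\<close>

locale graph_jet3 = graph_jet +
  fixes T0 T1 T2 T3 :: "real \<times> real \<Rightarrow> real"
  assumes deriv_r: "\<And>u. u \<in> \<Omega> \<Longrightarrow> (r has_derivative (\<lambda>h. T0 u * fst h + T1 u * snd h)) (at u)"
    and deriv_s: "\<And>u. u \<in> \<Omega> \<Longrightarrow> (s has_derivative (\<lambda>h. T1 u * fst h + T2 u * snd h)) (at u)"
    and deriv_t: "\<And>u. u \<in> \<Omega> \<Longrightarrow> (t has_derivative (\<lambda>h. T2 u * fst h + T3 u * snd h)) (at u)"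

lemma smooth_on_graph_jet3:
  assumes "open S" "smooth_on S f"
  obtains f1 f2 r s t T0 T1 T2 T3 where "graph_jet3 S f f1 f2 r s t T0 T1 T2 T3"
proof -
  define d1 where "d1 = (\<lambda>(g :: real \<times> real \<Rightarrow> real) u. frechet_derivative g (at u) (1, 0))"
  define d2 where "d2 = (\<lambda>(g :: real \<times> real \<Rightarrow> real) u. frechet_derivative g (at u) (0, 1))"
  have sm: "smooth_on S (d1 g)" "smooth_on S (d2 g)" if "smooth_on S g" for g
    unfolding d1_def d2_def using smooth_on_frechet_derivative[OF that] by auto
  have D: "(g has_derivative (\<lambda>h. d1 g u * fst h + d2 g u * snd h)) (at u)" if "smooth_on S g" "u \<in> S" for g u
    using smooth_on_partials[OF that] by (simp add: d1_def d2_def)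
  have mix: "d1 (d2 g) u = d2 (d1 g) u" if "smooth_on S g" "u \<in> S" for g u
    using smooth_on_mixed_partials[OF assms(1) that] by (simp add: d1_def d2_def)
  note f = assms(2)
  have d: "d1 g u = frechet_derivative g (at u) (1, 0)" "d2 g u = frechet_derivative g (at u) (0, 1)" for g u
    by (simp_all add: d1_def d2_def)
  \<comment> \<open>The two mixed second derivatives are known to agree only on \<open>S\<close>;
    openness of \<open>S\<close> transfers this to their derivatives.\<close>
  have s: "d1 (d1 (d2 f)) u = d1 (d2 (d1 f)) u" "d2 (d1 (d2 f)) u = d2 (d2 (d1 f)) u" if "u \<in> S" for u
  proof -
    have "d1 (d2 f) differentiable (at u)"
      using D[OF sm(1)[OF sm(2)[OF f]] that] by (auto simp: differentiable_def)
    then have "frechet_derivative (d1 (d2 f)) (at u) = frechet_derivative (d2 (d1 f)) (at u)"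
      by (rule frechet_derivative_transform_within_open[OF _ assms(1) that mix[OF f]])
    then show "d1 (d1 (d2 f)) u = d1 (d2 (d1 f)) u" "d2 (d1 (d2 f)) u = d2 (d2 (d1 f)) u"
      by (simp_all only: d[where g = "d1 (d2 f)"] d[where g = "d2 (d1 f)"])
  qed
  have "graph_jet3 S f (d1 f) (d2 f) (d1 (d1 f)) (d2 (d1 f)) (d2 (d2 f))
     (d1 (d1 (d1 f))) (d2 (d1 (d1 f))) (d2 (d2 (d1 f))) (d2 (d2 (d2 f)))"
  proof
    fix u assume u: "u \<in> S"
    show "(f has_derivative (\<lambda>h. d1 f u * fst h + d2 f u * snd h)) (at u)"
      and "(d1 f has_derivative (\<lambda>h. d1 (d1 f) u * fst h + d2 (d1 f) u * snd h)) (at u)"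
      and "(d1 (d1 f) has_derivative (\<lambda>h. d1 (d1 (d1 f)) u * fst h + d2 (d1 (d1 f)) u * snd h)) (at u)"
      by (intro D sm f u)+
    show "(d2 f has_derivative (\<lambda>h. d2 (d1 f) u * fst h + d2 (d2 f) u * snd h)) (at u)"
      using D[OF sm(2)[OF f] u] by (simp add: mix[OF f u])
    show "(d2 (d1 f) has_derivative (\<lambda>h. d2 (d1 (d1 f)) u * fst h + d2 (d2 (d1 f)) u * snd h)) (at u)"
      using D[OF sm(2)[OF sm(1)[OF f]] u] by (simp add: mix[OF sm(1)[OF f] u])
    show "(d2 (d2 f) has_derivative (\<lambda>h. d2 (d2 (d1 f)) u * fst h + d2 (d2 (d2 f)) u * snd h)) (at u)"
      using D[OF sm(2)[OF sm(2)[OF f]] u] by (simp add: mix[OF sm(2)[OF f] u] s[OF u])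
  qed (rule assms(1))
  then show ?thesis by (rule that)
qed

section \<open>Pointwise algebra of the Hessian and its kernel direction\<close>

lemma half_angle_exists:
  fixes C S :: real
  assumes "C\<^sup>2 + S\<^sup>2 = 1"
  obtains c d where "c\<^sup>2 + d\<^sup>2 = 1" "C = c\<^sup>2 - d\<^sup>2" "S = 2 * c * d"
proof -
  obtain x where x: "C = cos x" "S = sin x"
    using sincos_total_2pi[OF assms] by metis
  have "C = (cos (x / 2))\<^sup>2 - (sin (x / 2))\<^sup>2" "S = 2 * cos (x / 2) * sin (x / 2)"
    using cos_double[of "x / 2"] sin_double[of "x / 2"] x by simp_all
  then show ?thesis using that[of "cos (x / 2)" "sin (x / 2)"] by simp
qed

text \<open>The doubled angle of the kernel direction of the matrix with rows \<open>(r, s + 1/2)\<close> and \<open>(s - 1/2, t)\<close>.\<close>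

definition kernel_cos :: "real \<Rightarrow> real \<Rightarrow> real \<Rightarrow> real" where
  "kernel_cos r s t = (2 * s - (r + t) * (r - t)) / (1 + (r + t)\<^sup>2)"

definition kernel_sin :: "real \<Rightarrow> real \<Rightarrow> real \<Rightarrow> real" where
  "kernel_sin r s t = - ((r - t) + (r + t) * (2 * s)) / (1 + (r + t)\<^sup>2)"

text \<open>The last two identities form a linear system for the cosine and sine with determinant 1
  + m^2, where m = r + t, and the definitions are its solution. With A = r - t and B = 2 s the rank
  one condition reads A^2 + B^2 = 1 + m^2, which makes the solution a unit vector.\<close>

lemma kernel_cos_sin:
  assumes "r * t - s\<^sup>2 + 1 / 4 = 0"
  shows "(kernel_cos r s t)\<^sup>2 + (kernel_sin r s t)\<^sup>2 = 1"
    and "r - t = - kernel_sin r s t - (r + t) * kernel_cos r s t"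
    and "2 * s = kernel_cos r s t - (r + t) * kernel_sin r s t"
proof -
  define A B m where "A = r - t" "B = 2 * s" "m = r + t"
  note defs = this
  have nz: "1 + m\<^sup>2 \<noteq> 0" by (simp add: add_nonneg_eq_0_iff)
  have "A\<^sup>2 + B\<^sup>2 - (1 + m\<^sup>2) = - 4 * (r * t - s\<^sup>2 + 1 / 4)"
    by (simp add: defs algebra_simps power2_eq_square)
  then have AB: "A\<^sup>2 + B\<^sup>2 = 1 + m\<^sup>2" using assms by simp
  have C: "kernel_cos r s t = (B - m * A) / (1 + m\<^sup>2)" and S: "kernel_sin r s t = - (A + m * B) / (1 + m\<^sup>2)"
    by (simp_all add: kernel_cos_def kernel_sin_def defs)
  have "(B - m * A)\<^sup>2 + (A + m * B)\<^sup>2 = (A\<^sup>2 + B\<^sup>2) * (1 + m\<^sup>2)"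
    by (simp add: algebra_simps power2_eq_square)
  then have "(B - m * A)\<^sup>2 + (A + m * B)\<^sup>2 = (1 + m\<^sup>2)\<^sup>2"
    by (simp only: AB power2_eq_square[of "1 + m\<^sup>2"])
  then show "(kernel_cos r s t)\<^sup>2 + (kernel_sin r s t)\<^sup>2 = 1"
    unfolding C S using nz by (simp add: power_divide add_divide_distrib[symmetric] del: minus_add_distrib)
  have "- kernel_sin r s t - m * kernel_cos r s t = A * (1 + m\<^sup>2) / (1 + m\<^sup>2)"
    unfolding C S by (simp add: algebra_simps power2_eq_square diff_divide_distrib add_divide_distrib)
  then show "r - t = - kernel_sin r s t - (r + t) * kernel_cos r s t"
    using nz by (simp add: defs)
  have "kernel_cos r s t - m * kernel_sin r s t = B * (1 + m\<^sup>2) / (1 + m\<^sup>2)"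
    unfolding C S by (simp add: algebra_simps power2_eq_square diff_divide_distrib add_divide_distrib)
  then show "2 * s = kernel_cos r s t - (r + t) * kernel_sin r s t"
    using nz by (simp add: defs)
qed

text \<open>The trace and the two given equations determine all entries. In the orthonormal frame w
  = (c, d), w' = (-d, c) the Hessian becomes the matrix with rows (0, 1/2) and (1/2, m), where m = r
  + t.\<close>

lemma hessian_normal_form:
  fixes c d r s t :: real
  assumes "c\<^sup>2 + d\<^sup>2 = 1"
    and "r - t = - (2 * c * d) - (r + t) * (c\<^sup>2 - d\<^sup>2)" "2 * s = (c\<^sup>2 - d\<^sup>2) - (r + t) * (2 * c * d)"
  shows "r = - c * d + (r + t) * d\<^sup>2" "s = (c\<^sup>2 - d\<^sup>2) / 2 - (r + t) * c * d" "t = c * d + (r + t) * c\<^sup>2"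
proof -
  have "2 * r = (r + t) * (c\<^sup>2 + d\<^sup>2) + (r - t)" "2 * t = (r + t) * (c\<^sup>2 + d\<^sup>2) - (r - t)"
    using assms(1) by simp_all
  then show "r = - c * d + (r + t) * d\<^sup>2" "t = c * d + (r + t) * c\<^sup>2"
    unfolding assms(2) by (simp_all add: algebra_simps)
  show "s = (c\<^sup>2 - d\<^sup>2) / 2 - (r + t) * c * d"
    using assms(3) by (simp add: algebra_simps)
qed

text \<open>In vector form, H w = w'/2 and H w' = w/2 + m w' for the Hessian H. The first equation
  says that the differential of (p, q), which is H plus an antisymmetric part, kills w.\<close>

lemma kernel_equations:
  fixes c d r s t :: real
  assumes cd: "c\<^sup>2 + d\<^sup>2 = 1"
    and "r = - c * d + m * d\<^sup>2" "s = (c\<^sup>2 - d\<^sup>2) / 2 - m * c * d" "t = c * d + m * c\<^sup>2"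
  shows "c * r + d * s = - d / 2" "c * s + d * t = c / 2"
    "- d * r + c * s = c / 2 - m * d" "- d * s + c * t = d / 2 + m * c"
proof -
  have "c * r + d * s = - d * (c\<^sup>2 + d\<^sup>2) / 2" "c * s + d * t = c * (c\<^sup>2 + d\<^sup>2) / 2"
    "- d * r + c * s = c * (c\<^sup>2 + d\<^sup>2) / 2 - m * d * (c\<^sup>2 + d\<^sup>2)"
    "- d * s + c * t = d * (c\<^sup>2 + d\<^sup>2) / 2 + m * c * (c\<^sup>2 + d\<^sup>2)"
    unfolding assms(2-4) by (simp_all add: field_simps power2_eq_square)
  then show "c * r + d * s = - d / 2" "c * s + d * t = c / 2"
    "- d * r + c * s = c / 2 - m * d" "- d * s + c * t = d / 2 + m * c"
    by (simp_all add: cd)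
qed

text \<open>In the frame \<open>(w, w')\<close> with \<open>w = (c, d)\<close> the kernel direction, let \<open>U, V, W\<close> be the third
  derivatives in the directions \<open>www\<close>, \<open>www'\<close>, \<open>ww'w'\<close>. Differentiating the rank one equation
  gives \<open>V = m U\<close> and \<open>W = m V\<close>; differentiating the minimal surface equation along \<open>w\<close>
  then gives a positive multiple of \<open>U\<close>.\<close>

lemma third_derivatives:
  fixes c d m p q r s t T0 T1 T2 T3 :: real
  assumes cd: "c\<^sup>2 + d\<^sup>2 = 1"
    and H: "r = - c * d + m * d\<^sup>2" "s = (c\<^sup>2 - d\<^sup>2) / 2 - m * c * d" "t = c * d + m * c\<^sup>2"
    and Dx: "T0 * t + r * T2 - 2 * s * T1 = 0"
    and Dy: "T1 * t + r * T3 - 2 * s * T2 = 0"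
    and Mx: "(1 + q\<^sup>2) * T0 - 2 * p * q * T1 + (1 + p\<^sup>2) * T2 + (p * (s - 1 / 2) - q * r) = 0"
    and My: "(1 + q\<^sup>2) * T1 - 2 * p * q * T2 + (1 + p\<^sup>2) * T3 + (p * t - q * (s + 1 / 2)) = 0"
  shows "c * T0 + d * T1 = 0" "c * T1 + d * T2 = 0" "c * T2 + d * T3 = 0"
proof -
  define X Y Z where "X = c * T0 + d * T1" "Y = c * T1 + d * T2" "Z = c * T2 + d * T3"
  note XYZ = this
  define U V W where "U = c\<^sup>2 * X + 2 * c * d * Y + d\<^sup>2 * Z"
    "V = - (c * d) * X + (c\<^sup>2 - d\<^sup>2) * Y + c * d * Z" "W = d\<^sup>2 * X - 2 * c * d * Y + c\<^sup>2 * Z"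
  note UVW = this
  \<comment> \<open>The components of (p, q) in the frame (w, w').\<close>
  define a b where "a = c * p + d * q" "b = - d * p + c * q"
  note ab = this
  have "m * U - V = c * (T0 * t + r * T2 - 2 * s * T1) + d * (T1 * t + r * T3 - 2 * s * T2)"
    unfolding UVW XYZ H by (simp add: field_simps power2_eq_square)
  then have V: "V = m * U" unfolding Dx Dy by simp
  have "m * V - W = - d * (T0 * t + r * T2 - 2 * s * T1) + c * (T1 * t + r * T3 - 2 * s * T2)"
    unfolding UVW XYZ H by (simp add: field_simps power2_eq_square)
  then have W: "W = m * V" unfolding Dx Dy by simp
  \<comment> \<open>Along w both \<open>p\<close> and \<open>q\<close> are stationary, so
    differentiating the minimal surface equation in that direction leaves only third
    derivatives.\<close>
  have M: "(1 + q\<^sup>2) * X - 2 * p * q * Y + (1 + p\<^sup>2) * Z = 0"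
  proof -
    have "(1 + q\<^sup>2) * X - 2 * p * q * Y + (1 + p\<^sup>2) * Z =
       c * ((1 + q\<^sup>2) * T0 - 2 * p * q * T1 + (1 + p\<^sup>2) * T2 + (p * (s - 1 / 2) - q * r)) +
       d * ((1 + q\<^sup>2) * T1 - 2 * p * q * T2 + (1 + p\<^sup>2) * T3 + (p * t - q * (s + 1 / 2)))
       - p * (c * s + d * t - c / 2) + q * (c * r + d * s - (- d / 2))"
      unfolding XYZ by (simp add: algebra_simps)
    then show ?thesis
      unfolding Mx My kernel_equations(1,2)[OF cd H] by simp
  qed
  have "(c\<^sup>2 + d\<^sup>2) * (X + Z) = U + W"
    unfolding UVW by (simp add: algebra_simps)
  then have XZ: "X + Z = U + W" by (simp add: cd)
  have "(c\<^sup>2 + d\<^sup>2) * (c\<^sup>2 + d\<^sup>2) * (q\<^sup>2 * X - 2 * p * q * Y + p\<^sup>2 * Z) = b\<^sup>2 * U - 2 * a * b * V + a\<^sup>2 * W"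
    unfolding UVW ab by (simp add: algebra_simps power2_eq_square)
  then have "q\<^sup>2 * X - 2 * p * q * Y + p\<^sup>2 * Z = b\<^sup>2 * U - 2 * a * b * V + a\<^sup>2 * W"
    by (simp add: cd)
  with M XZ have "U + W + (b\<^sup>2 * U - 2 * a * b * V + a\<^sup>2 * W) = 0"
    by (simp add: algebra_simps)
  \<comment> \<open>After substituting \<open>V\<close> and \<open>W\<close>, the coefficient of
    \<open>U\<close> becomes 1 + m^2 plus a perfect square.\<close>
  then have "U * (1 + m\<^sup>2 + (b - a * m)\<^sup>2) = 0"
    unfolding W V by (simp add: algebra_simps power2_eq_square)
  moreover have "1 + m\<^sup>2 + (b - a * m)\<^sup>2 > 0"
    by (simp add: add_pos_nonneg)
  ultimately have U0: "U = 0" by simp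
  then have VW0: "V = 0" "W = 0" using V W by simp_all
  have "(c\<^sup>2 + d\<^sup>2) * (c\<^sup>2 + d\<^sup>2) * X = c\<^sup>2 * U - 2 * c * d * V + d\<^sup>2 * W"
    "(c\<^sup>2 + d\<^sup>2) * (c\<^sup>2 + d\<^sup>2) * Y = c * d * U + (c\<^sup>2 - d\<^sup>2) * V - c * d * W"
    "(c\<^sup>2 + d\<^sup>2) * (c\<^sup>2 + d\<^sup>2) * Z = d\<^sup>2 * U + 2 * c * d * V + c\<^sup>2 * W"
    unfolding UVW by (simp_all add: algebra_simps power2_eq_square)
  then have "X = 0" "Y = 0" "Z = 0"
    by (simp_all add: cd U0 VW0)
  then show "c * T0 + d * T1 = 0" "c * T1 + d * T2 = 0" "c * T2 + d * T3 = 0"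
    by (simp_all add: XYZ)
qed

text \<open>A symmetric matrix killing (c, d) is a multiple of the projection onto the orthogonal
  direction, and the multiple is its trace.\<close>

lemma rank_one_hessian_variation:
  fixes c d :: real
  assumes cd: "c\<^sup>2 + d\<^sup>2 = 1" and 1: "c * r' + d * s' = 0" and 2: "c * s' + d * t' = 0"
  shows "r' = d\<^sup>2 * (r' + t')" "s' = - (c * d) * (r' + t')" "t' = c\<^sup>2 * (r' + t')"
proof -
  have "d\<^sup>2 * (r' + t') = (c\<^sup>2 + d\<^sup>2) * r' - c * (c * r' + d * s') + d * (c * s' + d * t')"
    "- (c * d) * (r' + t') = (c\<^sup>2 + d\<^sup>2) * s' - d * (c * r' + d * s') - c * (c * s' + d * t')"
    "c\<^sup>2 * (r' + t') = (c\<^sup>2 + d\<^sup>2) * t' + c * (c * r' + d * s') - d * (c * s' + d * t')"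
    by (simp_all add: algebra_simps power2_eq_square)
  then show "r' = d\<^sup>2 * (r' + t')" "s' = - (c * d) * (r' + t')" "t' = c\<^sup>2 * (r' + t')"
    unfolding 1 2 cd by simp_all
qed

text \<open>The numerator M dN - N dM of the quotient rule vanishes when dN = C dM and N = C M at
  \<open>u\<close>. Only the value \<open>C\<close> at this one point enters.\<close>

lemma has_derivative_zero_quotient:
  fixes N M :: "'a::real_normed_vector \<Rightarrow> real"
  assumes "(N has_derivative (\<lambda>h. C * M' h)) (at u)" "(M has_derivative M') (at u)" "M u \<noteq> 0" "N u / M u = C"
  shows "((\<lambda>w. N w / M w) has_derivative (\<lambda>h. 0)) (at u)"
proof (rule has_derivative_eq_rhs[OF has_derivative_divide'[OF assms(1-3)]])
  have "N u = C * M u" using assms(3,4) by (simp add: field_simps)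
  then show "(\<lambda>h. (C * M' h * M u - N u * M' h) / (M u * M u)) = (\<lambda>h. 0)"
    by simp
qed

lemma has_derivative_eq_0_on:
  assumes "open S" "u \<in> S" "\<And>w. w \<in> S \<Longrightarrow> g w = 0" "(g has_derivative D) (at u)"
  shows "D = (\<lambda>h. 0)"
proof -
  have "((\<lambda>w. 0) has_derivative D) (at u)"
    by (rule has_derivative_transform_within_open[OF assms(4,1,2)]) (rule assms(3))
  then show ?thesis
    using has_derivative_unique has_derivative_const by blast
qed

section \<open>The differentiated equations and constancy of the kernel direction\<close>

locale rank_one_minimal_jet = graph_jet3 +
  assumes rank_one: "\<And>u. u \<in> \<Omega> \<Longrightarrow> r u * t u - (s u)\<^sup>2 + 1 / 4 = 0"
    and minimal: "\<And>u. u \<in> \<Omega> \<Longrightarrow> (1 + (q u)\<^sup>2) * r u - 2 * p u * q u * s u + (1 + (p u)\<^sup>2) * t u = 0"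
begin

lemma rank_one_deriv:
  assumes u: "u \<in> \<Omega>"
  shows "T0 u * t u + r u * T2 u - 2 * s u * T1 u = 0" "T1 u * t u + r u * T3 u - 2 * s u * T2 u = 0"
proof -
  have "((\<lambda>w. r w * t w - s w * s w + 1 / 4) has_derivative
     (\<lambda>h. (r u * (T2 u * fst h + T3 u * snd h) + (T0 u * fst h + T1 u * snd h) * t u)
        - (s u * (T1 u * fst h + T2 u * snd h) + (T1 u * fst h + T2 u * snd h) * s u) + 0)) (at u)"
    by (intro has_derivative_add has_derivative_diff has_derivative_mult has_derivative_const
        deriv_r deriv_s deriv_t u)
  from has_derivative_eq_0_on[OF open_domain u _ this] rank_one
  have eq: "(\<lambda>h. (r u * (T2 u * fst h + T3 u * snd h) + (T0 u * fst h + T1 u * snd h) * t u)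
        - (s u * (T1 u * fst h + T2 u * snd h) + (T1 u * fst h + T2 u * snd h) * s u) + 0) = (\<lambda>h. 0)"
    by (simp add: power2_eq_square)
  show "T0 u * t u + r u * T2 u - 2 * s u * T1 u = 0" "T1 u * t u + r u * T3 u - 2 * s u * T2 u = 0"
    using fun_cong[OF eq, of "(1, 0)"] fun_cong[OF eq, of "(0, 1)"] by (simp_all add: algebra_simps)
qed

text \<open>Differentiating \<open>p\<close> and \<open>q\<close> produces 2p(rt - s^2) and 2q(rt -
  s^2). The rank one equation turns them into -p/2 and -q/2, so what remains is linear in the second
  derivatives.\<close>

lemma minimal_deriv:
  assumes u: "u \<in> \<Omega>"
  shows "(1 + (q u)\<^sup>2) * T0 u - 2 * p u * q u * T1 u + (1 + (p u)\<^sup>2) * T2 u + (p u * (s u - 1 / 2) - q u * r u) = 0"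
    "(1 + (q u)\<^sup>2) * T1 u - 2 * p u * q u * T2 u + (1 + (p u)\<^sup>2) * T3 u + (p u * t u - q u * (s u + 1 / 2)) = 0"
proof -
  let ?dp = "\<lambda>h. r u * fst h + (s u + 1 / 2) * snd h" and ?dq = "\<lambda>h. (s u - 1 / 2) * fst h + t u * snd h"
  let ?D = "\<lambda>h. ((1 + q u * q u) * (T0 u * fst h + T1 u * snd h) + (0 + (q u * ?dq h + ?dq h * q u)) * r u)
     - ((2 * (p u * q u)) * (T1 u * fst h + T2 u * snd h) + (2 * (p u * ?dq h + ?dp h * q u)) * s u)
     + ((1 + p u * p u) * (T2 u * fst h + T3 u * snd h) + (0 + (p u * ?dp h + ?dp h * p u)) * t u)"
  have "((\<lambda>w. (1 + q w * q w) * r w - (2 * (p w * q w)) * s w + (1 + p w * p w) * t w) has_derivative ?D) (at u)"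
    by (intro has_derivative_add has_derivative_diff has_derivative_mult has_derivative_mult_right has_derivative_const
        deriv_r deriv_s deriv_t deriv_p deriv_q u)
  from has_derivative_eq_0_on[OF open_domain u _ this] minimal
  have eq: "?D = (\<lambda>h. 0)"
    by (simp add: power2_eq_square mult.assoc)
  have det: "r u * t u = s u * s u - 1 / 4"
    using rank_one[OF u] by (simp add: power2_eq_square)
  have "?D (1, 0) = (1 + (q u)\<^sup>2) * T0 u - 2 * p u * q u * T1 u + (1 + (p u)\<^sup>2) * T2 u - q u * r u + p u * s u
      + 2 * p u * (r u * t u - s u * s u)"
    by (simp add: algebra_simps power2_eq_square)
  then show "(1 + (q u)\<^sup>2) * T0 u - 2 * p u * q u * T1 u + (1 + (p u)\<^sup>2) * T2 u + (p u * (s u - 1 / 2) - q u * r u) = 0"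
    unfolding fun_cong[OF eq, of "(1, 0)"] det by (simp add: algebra_simps)
  have "?D (0, 1) = (1 + (q u)\<^sup>2) * T1 u - 2 * p u * q u * T2 u + (1 + (p u)\<^sup>2) * T3 u + p u * t u - q u * s u
      + 2 * q u * (r u * t u - s u * s u)"
    by (simp add: algebra_simps power2_eq_square)
  then show "(1 + (q u)\<^sup>2) * T1 u - 2 * p u * q u * T2 u + (1 + (p u)\<^sup>2) * T3 u + (p u * t u - q u * (s u + 1 / 2)) = 0"
    unfolding fun_cong[OF eq, of "(0, 1)"] det by (simp add: algebra_simps)
qed

text \<open>Every directional derivative of the Hessian kills the kernel direction, hence is its
  trace \<open>\<mu>\<close> times a fixed projection. Then r - t and 2 s vary by -C
  \<open>\<mu>\<close> and -S \<open>\<mu>\<close>, so the numerators of \<open>kernel_cos\<close>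
  and \<open>kernel_sin\<close> vary by C and S times the variation of their common
  denominator.\<close>

lemma kernel_direction_deriv:
  assumes u: "u \<in> \<Omega>"
  shows "((\<lambda>w. kernel_cos (r w) (s w) (t w)) has_derivative (\<lambda>h. 0)) (at u)"
    "((\<lambda>w. kernel_sin (r w) (s w) (t w)) has_derivative (\<lambda>h. 0)) (at u)"
proof -
  define C S m where "C = kernel_cos (r u) (s u) (t u)" "S = kernel_sin (r u) (s u) (t u)" "m = r u + t u"
  note CSm = this
  note kcs = kernel_cos_sin[OF rank_one[OF u], folded CSm]
  \<comment> \<open>The half angle is chosen at the single point \<open>u\<close>; no regularity in
    \<open>u\<close> is asked of it.\<close>
  obtain c d where cd: "c\<^sup>2 + d\<^sup>2 = 1" and C: "C = c\<^sup>2 - d\<^sup>2" and S: "S = 2 * c * d"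
    using half_angle_exists[OF kcs(1)] by metis
  note H = hessian_normal_form[OF cd kcs(2,3)[unfolded C S CSm(3)], folded CSm(3)]
  note T = third_derivatives[OF cd H rank_one_deriv[OF u] minimal_deriv[OF u]]
  define rh sh th where "rh = (\<lambda>h. T0 u * fst h + T1 u * snd h)" "sh = (\<lambda>h. T1 u * fst h + T2 u * snd h)"
    "th = (\<lambda>h. T2 u * fst h + T3 u * snd h)"
  note h = this
  have "c * rh h + d * sh h = (c * T0 u + d * T1 u) * fst h + (c * T1 u + d * T2 u) * snd h"
    "c * sh h + d * th h = (c * T1 u + d * T2 u) * fst h + (c * T2 u + d * T3 u) * snd h" for h
    unfolding h by (simp_all add: algebra_simps)
  then have zero: "c * rh h + d * sh h = 0" "c * sh h + d * th h = 0" for h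
    unfolding T by simp_all
  define \<mu> where "\<mu> = (\<lambda>h. rh h + th h)"
  have \<mu>: "\<mu> h = rh h + th h" for h by (simp add: \<mu>_def)
  note V = rank_one_hessian_variation[OF cd zero, folded \<mu>]
  have dA: "rh h - th h = - C * \<mu> h" and dB: "2 * sh h = - S * \<mu> h" for h
    unfolding C S V by (simp_all add: algebra_simps)
  note deriv = deriv_r[OF u, folded h] deriv_s[OF u, folded h] deriv_t[OF u, folded h]
  have M: "((\<lambda>w. 1 + (r w + t w) * (r w + t w)) has_derivative
      (\<lambda>h. 2 * m * \<mu> h)) (at u)"
    by (rule has_derivative_eq_rhs, (rule has_derivative_add has_derivative_mult has_derivative_const deriv)+)
       (simp add: fun_eq_iff \<mu>_def CSm(3) algebra_simps)
  have nz: "1 + (r u + t u) * (r u + t u) \<noteq> 0"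
    using zero_le_square[of "r u + t u"] by linarith
  have A: "r u - t u = - S - m * C" and B: "2 * s u = C - m * S"
    using kcs(2,3) by (simp_all add: CSm(3))
  have "((\<lambda>w. 2 * s w - (r w + t w) * (r w - t w)) has_derivative
      (\<lambda>h. 2 * sh h - ((r u + t u) * (rh h - th h) + (rh h + th h) * (r u - t u)))) (at u)"
    by (intro has_derivative_diff has_derivative_mult has_derivative_add has_derivative_mult_right deriv)
  moreover have "2 * sh h - ((r u + t u) * (rh h - th h) + (rh h + th h) * (r u - t u)) = C * (2 * m * \<mu> h)" for h
    unfolding dA dB A \<mu>[symmetric] CSm(3)[symmetric] by (simp add: algebra_simps)
  ultimately have N: "((\<lambda>w. 2 * s w - (r w + t w) * (r w - t w)) has_derivative (\<lambda>h. C * (2 * m * \<mu> h))) (at u)"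
    by simp
  show "((\<lambda>w. kernel_cos (r w) (s w) (t w)) has_derivative (\<lambda>h. 0)) (at u)"
    unfolding kernel_cos_def power2_eq_square
    by (rule has_derivative_zero_quotient[OF N M nz])
       (simp add: CSm(1) kernel_cos_def power2_eq_square)
  have "((\<lambda>w. - ((r w - t w) + (r w + t w) * (2 * s w))) has_derivative
      (\<lambda>h. - ((rh h - th h) + ((r u + t u) * (2 * sh h) + (rh h + th h) * (2 * s u))))) (at u)"
    by (intro has_derivative_minus has_derivative_diff has_derivative_mult has_derivative_add has_derivative_mult_right deriv)
  moreover have "- ((rh h - th h) + ((r u + t u) * (2 * sh h) + (rh h + th h) * (2 * s u))) = S * (2 * m * \<mu> h)" for h
    unfolding dA dB B \<mu>[symmetric] CSm(3)[symmetric] by (simp add: algebra_simps)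
  ultimately have N': "((\<lambda>w. - ((r w - t w) + (r w + t w) * (2 * s w))) has_derivative (\<lambda>h. S * (2 * m * \<mu> h))) (at u)"
    by simp
  show "((\<lambda>w. kernel_sin (r w) (s w) (t w)) has_derivative (\<lambda>h. 0)) (at u)"
    unfolding kernel_sin_def power2_eq_square
    by (rule has_derivative_zero_quotient[OF N' M nz])
       (simp add: CSm(2) kernel_sin_def power2_eq_square)
qed

text \<open>The doubled-angle functions have zero derivative on a connected open set, so a half
  angle taken at one point serves everywhere.\<close>

lemma hessian_constant_kernel:
  assumes "connected \<Omega>" "\<Omega> \<noteq> {}"
  obtains c d where "c\<^sup>2 + d\<^sup>2 = 1"
    "\<And>u. u \<in> \<Omega> \<Longrightarrow> r u = - c * d + (r u + t u) * d\<^sup>2"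
    "\<And>u. u \<in> \<Omega> \<Longrightarrow> s u = (c\<^sup>2 - d\<^sup>2) / 2 - (r u + t u) * c * d"
    "\<And>u. u \<in> \<Omega> \<Longrightarrow> t u = c * d + (r u + t u) * c\<^sup>2"
proof -
  obtain u0 where u0: "u0 \<in> \<Omega>" using assms(2) by auto
  obtain c d where cd: "c\<^sup>2 + d\<^sup>2 = 1" "kernel_cos (r u0) (s u0) (t u0) = c\<^sup>2 - d\<^sup>2"
      "kernel_sin (r u0) (s u0) (t u0) = 2 * c * d"
    using half_angle_exists[OF kernel_cos_sin(1)[OF rank_one[OF u0]]] by metis
  have CS: "kernel_cos (r u) (s u) (t u) = c\<^sup>2 - d\<^sup>2" "kernel_sin (r u) (s u) (t u) = 2 * c * d" if u: "u \<in> \<Omega>" for u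
    unfolding cd(2,3)[symmetric]
    by (rule has_derivative_zero_unique_connected[OF open_domain assms(1) _ u u0]; rule kernel_direction_deriv; assumption)+
  have "r u - t u = - (2 * c * d) - (r u + t u) * (c\<^sup>2 - d\<^sup>2)" "2 * s u = (c\<^sup>2 - d\<^sup>2) - (r u + t u) * (2 * c * d)"
    if u: "u \<in> \<Omega>" for u
    using kernel_cos_sin(2,3)[OF rank_one[OF u]] unfolding CS[OF u] .
  from that[OF cd(1) hessian_normal_form[OF cd(1) this]] show ?thesis
    by blast
qed

end

section \<open>Classification\<close>

context rank_one_minimal_jet
begin

text \<open>The constants \<open>\<beta>\<close> and \<open>k\<close> determine the gradient of
  \<open>f\<close>, and \<open>e\<close> accounts for the last constant of integration.
  \<open>c\<close> and \<open>d\<close> give the rotation, \<open>\<beta>\<close> and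
  \<open>e\<close> the left translation.\<close>

lemma classification:
  assumes conn: "connected \<Omega>" and ne: "\<Omega> \<noteq> {}"
  obtains c d e b k where "c\<^sup>2 + d\<^sup>2 = 1"
    "\<And>u. u \<in> \<Omega> \<Longrightarrow> f u + e - b * (c * fst u + d * snd u) / 2 =
      rank_one_fun k (c * fst u + d * snd u, - d * fst u + c * snd u + b)"
proof -
  obtain u0 where u0: "u0 \<in> \<Omega>" using ne by auto
  have const: "g u = g u0" if "\<And>w. w \<in> \<Omega> \<Longrightarrow> (g has_derivative (\<lambda>h. 0)) (at w)" "u \<in> \<Omega>"
    for g :: "real \<times> real \<Rightarrow> real" and u
    by (rule has_derivative_zero_unique_connected[OF open_domain conn _ that(2) u0]) (rule that(1))
  obtain c d where cd: "c\<^sup>2 + d\<^sup>2 = 1"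
    and H: "\<And>u. u \<in> \<Omega> \<Longrightarrow> r u = - c * d + (r u + t u) * d\<^sup>2"
      "\<And>u. u \<in> \<Omega> \<Longrightarrow> s u = (c\<^sup>2 - d\<^sup>2) / 2 - (r u + t u) * c * d"
      "\<And>u. u \<in> \<Omega> \<Longrightarrow> t u = c * d + (r u + t u) * c\<^sup>2"
    using hessian_constant_kernel[OF conn ne] by metis
  note K = kernel_equations[OF cd H]
  define m where "m = (\<lambda>u. r u + t u)"
  define X where "X = (\<lambda>u. c * fst u + d * snd u)"
  define Y where "Y = (\<lambda>u. - d * fst u + c * snd u)"
  have dX: "(X has_derivative X) (at u)" and dY: "(Y has_derivative Y) (at u)" for u
    unfolding X_def Y_def
    by (intro has_derivative_add has_derivative_mult_right has_derivative_fst has_derivative_snd has_derivative_ident)+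
  have swap: "c * X u - d * Y u = fst u" "d * X u + c * Y u = snd u" for u
  proof -
    have "c * X u - d * Y u = (c\<^sup>2 + d\<^sup>2) * fst u" "d * X u + c * Y u = (c\<^sup>2 + d\<^sup>2) * snd u"
      by (simp_all add: X_def Y_def algebra_simps power2_eq_square)
    then show "c * X u - d * Y u = fst u" "d * X u + c * Y u = snd u" by (simp_all add: cd)
  qed
  \<comment> \<open>\<open>a\<close> and \<open>b\<close> are the components of (p, q) in the
    rotated frame. This function \<open>b\<close> is not the constant \<open>b\<close> of the
    conclusion, for which \<open>\<beta>\<close> is supplied at the end.\<close>
  define a where "a = (\<lambda>u. c * p u + d * q u)"
  define b where "b = (\<lambda>u. - d * p u + c * q u)"
  have swap': "c * a u - d * b u = p u" "d * a u + c * b u = q u" for u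
  proof -
    have "c * a u - d * b u = (c\<^sup>2 + d\<^sup>2) * p u" "d * a u + c * b u = (c\<^sup>2 + d\<^sup>2) * q u"
      by (simp_all add: a_def b_def algebra_simps power2_eq_square)
    then show "c * a u - d * b u = p u" "d * a u + c * b u = q u" by (simp_all add: cd)
  qed
  have da: "(a has_derivative Y) (at u)" and db: "(b has_derivative (\<lambda>h. m u * Y h)) (at u)" if u: "u \<in> \<Omega>" for u
  proof -
    have "(a has_derivative (\<lambda>h. c * (r u * fst h + (s u + 1 / 2) * snd h) + d * ((s u - 1 / 2) * fst h + t u * snd h))) (at u)"
      unfolding a_def by (intro has_derivative_add has_derivative_mult_right deriv_p deriv_q u)
    moreover have "c * (r u * fst h + (s u + 1 / 2) * snd h) + d * ((s u - 1 / 2) * fst h + t u * snd h) =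
        (c * r u + d * s u - d / 2) * fst h + (c * s u + d * t u + c / 2) * snd h" for h :: "real \<times> real"
      by (simp add: algebra_simps)
    ultimately show "(a has_derivative Y) (at u)"
      by (simp add: K[OF u u u] Y_def)
    have "(b has_derivative (\<lambda>h. - d * (r u * fst h + (s u + 1 / 2) * snd h) + c * ((s u - 1 / 2) * fst h + t u * snd h))) (at u)"
      unfolding b_def by (intro has_derivative_add has_derivative_mult_right deriv_p deriv_q u)
    moreover have "- d * (r u * fst h + (s u + 1 / 2) * snd h) + c * ((s u - 1 / 2) * fst h + t u * snd h) =
        (- d * r u + c * s u - c / 2) * fst h + (- d * s u + c * t u - d / 2) * snd h" for h :: "real \<times> real"
      by (simp add: algebra_simps)
    then have "- d * (r u * fst h + (s u + 1 / 2) * snd h) + c * ((s u - 1 / 2) * fst h + t u * snd h) = m u * Y h" for h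
      unfolding K(3,4)[OF u u u] by (simp add: Y_def m_def algebra_simps)
    ultimately show "(b has_derivative (\<lambda>h. m u * Y h)) (at u)" by simp
  qed
  \<comment> \<open>The minimal surface equation in the rotated frame, where the Hessian has rows
    (0, 1/2) and (1/2, m).\<close>
  have ab: "m u * (1 + (a u)\<^sup>2) = a u * b u" if u: "u \<in> \<Omega>" for u
  proof -
    have "(1 + (q u)\<^sup>2) * r u - 2 * p u * q u * s u + (1 + (p u)\<^sup>2) * t u =
        m u + (d * a u + c * b u) * (q u * r u - p u * s u) + (c * a u - d * b u) * (p u * t u - q u * s u)"
      unfolding swap' by (simp add: m_def algebra_simps power2_eq_square)
    also have "\<dots> = m u + a u * (p u * (- d * s u + c * t u) - q u * (- d * r u + c * s u))
        - b u * (p u * (c * s u + d * t u) - q u * (c * r u + d * s u))"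
      by (simp add: algebra_simps)
    also have "\<dots> = m u + a u * (m u * (c * p u + d * q u) - (- d * p u + c * q u) / 2)
        - b u * (c * p u + d * q u) / 2"
      unfolding K[OF u u u] by (simp add: m_def field_simps)
    also have "\<dots> = m u * (1 + (a u)\<^sup>2) - a u * b u"
      unfolding a_def[symmetric] b_def[symmetric] fun_cong[OF a_def, of u, symmetric] fun_cong[OF b_def, of u, symmetric]
      by (simp add: field_simps power2_eq_square)
    finally show ?thesis using minimal[OF u] by simp
  qed
  define \<beta> where "\<beta> = a u0 - Y u0"
  have a: "a u = Y u + \<beta>" if u: "u \<in> \<Omega>" for u
  proof -
    have "((\<lambda>w. a w - Y w) has_derivative (\<lambda>h. 0)) (at w)" if "w \<in> \<Omega>" for w
      using has_derivative_diff[OF da[OF that] dY] by simp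
    from const[OF this u] show ?thesis by (simp add: \<beta>_def)
  qed
  define R where "R = (\<lambda>u. sqrt (1 + (a u)\<^sup>2))"
  have R: "R u > 0" "(R u)\<^sup>2 = 1 + (a u)\<^sup>2" for u
    by (simp_all add: R_def add_pos_nonneg)
  have dR: "(R has_derivative (\<lambda>h. a u * Y h / R u)) (at u)" if u: "u \<in> \<Omega>" for u
  proof -
    have "((\<lambda>u. 1 + a u * a u) has_derivative (\<lambda>h. 0 + (a u * Y h + Y h * a u))) (at u)"
      by (intro has_derivative_add has_derivative_const has_derivative_mult da u)
    moreover have "1 + a u * a u > 0" by (simp add: add_pos_nonneg)
    ultimately have "((\<lambda>u. sqrt (1 + a u * a u)) has_derivative
        (\<lambda>h. (0 + (a u * Y h + Y h * a u)) * (inverse (sqrt (1 + a u * a u)) / 2))) (at u)"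
      by (intro has_derivative_real_sqrt)
    moreover have "R = (\<lambda>u. sqrt (1 + a u * a u))" by (simp add: R_def power2_eq_square)
    ultimately show ?thesis
      by (simp add: field_simps)
  qed
  define k where "k = - (b u0 / R u0)"
  have b: "b u = - k * R u" if u: "u \<in> \<Omega>" for u
  proof -
    have "((\<lambda>w. b w / R w) has_derivative (\<lambda>h. 0)) (at w)" if w: "w \<in> \<Omega>" for w
    proof (rule has_derivative_eq_rhs[OF has_derivative_divide'[OF db[OF w] dR[OF w]]])
      \<comment> \<open>The numerator of the quotient rule is proportional to m R^2 - a b, which is
        zero by \<open>ab\<close>.\<close>
      have "m w * R w - b w * (a w / R w) = (m w * (R w)\<^sup>2 - a w * b w) / R w"
        using R(1)[of w] by (simp add: field_simps power2_eq_square)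
      also have "\<dots> = 0" using ab[OF w] by (simp add: R(2))
      finally have zero: "m w * R w - b w * (a w / R w) = 0" .
      have "m w * Y h * R w - b w * (a w * Y h / R w) = (m w * R w - b w * (a w / R w)) * Y h" for h
        by (simp add: algebra_simps)
      then show "(\<lambda>h. (m w * Y h * R w - b w * (a w * Y h / R w)) / (R w * R w)) = (\<lambda>h. 0)"
        unfolding zero by simp
    qed (use R(1)[of w] in simp)
    from const[OF this u] have "b u / R u = - k" by (simp add: k_def)
    then show ?thesis using R(1)[of u] by (simp add: field_simps)
  qed
  have hyp: "hyp_profile (X u, Y u + \<beta>) = R u" if "u \<in> \<Omega>" for u
    by (simp add: hyp_profile_def R_def a[OF that])
  have df: "((\<lambda>u. f u - \<beta> * X u / 2 - rank_one_fun k (X u, Y u + \<beta>)) has_derivative (\<lambda>h. 0)) (at u)" if u: "u \<in> \<Omega>" for u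
  proof -
    have "((\<lambda>u. (X u, Y u + \<beta>)) has_derivative (\<lambda>h. (X h, Y h + 0))) (at u)"
      by (intro has_derivative_Pair has_derivative_add has_derivative_const dX dY)
    from has_derivative_compose[OF this has_derivative_rank_one_fun]
    have "((\<lambda>u. rank_one_fun k (X u, Y u + \<beta>)) has_derivative
        (\<lambda>h. (Y u + \<beta>) / 2 * X h + (X u / 2 - k * R u) * Y h)) (at u)"
      by (simp add: hyp[OF u])
    moreover have "((\<lambda>u. \<beta> * X u / 2) has_derivative (\<lambda>h. \<beta> * X h / 2)) (at u)"
      by (intro bounded_linear.has_derivative[OF bounded_linear_divide] has_derivative_mult_right dX)
    ultimately have "((\<lambda>u. f u - \<beta> * X u / 2 - rank_one_fun k (X u, Y u + \<beta>)) has_derivative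
       (\<lambda>h. (f1 u * fst h + f2 u * snd h) - \<beta> * X h / 2 - ((Y u + \<beta>) / 2 * X h + (X u / 2 - k * R u) * Y h))) (at u)"
      by (intro has_derivative_diff deriv_f u)
    moreover have "(f1 u * fst h + f2 u * snd h) - \<beta> * X h / 2 - ((Y u + \<beta>) / 2 * X h + (X u / 2 - k * R u) * Y h) = 0" for h
    proof -
      \<comment> \<open>In rotated coordinates df = (a - Y/2) dX + (b + X/2) dY. Inserting the
        formulas for \<open>a\<close> and \<open>b\<close> gives the differential of the model at
        (X, Y + \<open>\<beta>\<close>) plus \<open>\<beta>\<close> dX / 2.\<close>
      have "f1 u * fst h + f2 u * snd h = (p u - snd u / 2) * fst h + (q u + fst u / 2) * snd h"
        by (simp add: p_def q_def)
      also have "\<dots> = ((c * a u - d * b u) - (d * X u + c * Y u) / 2) * fst h + ((d * a u + c * b u) + (c * X u - d * Y u) / 2) * snd h"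
        by (simp only: swap swap')
      also have "\<dots> = (a u - Y u / 2) * X h + (b u + X u / 2) * Y h"
        by (simp add: X_def Y_def field_simps)
      also have "\<dots> = (Y u / 2 + \<beta>) * X h + (X u / 2 - k * R u) * Y h"
        by (simp add: a[OF u] b[OF u])
      finally show ?thesis by (simp add: field_simps)
    qed
    ultimately show ?thesis by simp
  qed
  define e where "e = - (f u0 - \<beta> * X u0 / 2 - rank_one_fun k (X u0, Y u0 + \<beta>))"
  have "f u + e - \<beta> * X u / 2 = rank_one_fun k (X u, Y u + \<beta>)" if "u \<in> \<Omega>" for u
    using const[OF df that] by (simp add: e_def)
  then show ?thesis
    using that[OF cd, of e \<beta> k] by (simp add: X_def Y_def)
qed

end

theorem theorem5p7:
  shows "(\<forall>k :: real. minimal_surface UNIV (graph_param (rank_one_fun k)) \<and>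
                      gauss_map_rank_one UNIV (graph_param (rank_one_fun k)))
       \<and> (\<forall>(\<Omega> :: (real \<times> real) set) (f :: real \<times> real \<Rightarrow> real).
            open \<Omega> \<longrightarrow> connected \<Omega> \<longrightarrow> smooth_on \<Omega> f \<longrightarrow>
            minimal_surface \<Omega> (graph_param f) \<longrightarrow> gauss_map_rank_one \<Omega> (graph_param f) \<longrightarrow>
            (\<exists>(k :: real) (\<phi> :: h3 \<Rightarrow> h3).
               heis_isometry \<phi> \<and>
               openin (top_of_set (graph_on UNIV (rank_one_fun k))) (\<phi> ` graph_on \<Omega> f)))"
proof (intro conjI allI impI minimal_surface_rank_one gauss_map_rank_one_rank_one)
  fix \<Omega> :: "(real \<times> real) set" and f :: "real \<times> real \<Rightarrow> real"
  assume \<Omega>: "open \<Omega>" "connected \<Omega>" and f: "smooth_on \<Omega> f"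
    and min: "minimal_surface \<Omega> (graph_param f)" and rank: "gauss_map_rank_one \<Omega> (graph_param f)"
  show "\<exists>k \<phi>. heis_isometry \<phi> \<and> openin (top_of_set (graph_on UNIV (rank_one_fun k))) (\<phi> ` graph_on \<Omega> f)"
  \<comment> \<open>The integration arguments need a base point. Over the empty domain any isometry
    serves, for instance the identity \<open>heis_motion 1 0 0 0\<close>.\<close>
  proof (cases "\<Omega> = {}")
    case True
    have "heis_isometry (heis_motion 1 0 0 0)"
      by (rule heis_isometry_motion) simp
    then show ?thesis
      using True by (auto simp: graph_on_def)
  next
    case False
    obtain f1 f2 r s t T0 T1 T2 T3 where "graph_jet3 \<Omega> f f1 f2 r s t T0 T1 T2 T3"
      using smooth_on_graph_jet3[OF \<Omega>(1) f] .
    then interpret graph_jet3 \<Omega> f f1 f2 r s t T0 T1 T2 T3 .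
    interpret rank_one_minimal_jet \<Omega> f f1 f2 r s t T0 T1 T2 T3
      by unfold_locales (use rank_one_equation[OF rank] minimal_surface_equation[OF min] in auto)
    obtain c d e b k where "c\<^sup>2 + d\<^sup>2 = 1"
      "\<And>u. u \<in> \<Omega> \<Longrightarrow> f u + e - b * (c * fst u + d * snd u) / 2 =
        rank_one_fun k (c * fst u + d * snd u, - d * fst u + c * snd u + b)"
      by (rule classification[OF \<Omega>(2) False]) blast
    then show ?thesis
      using heis_isometry_motion openin_motion_graph[OF \<Omega>(1)] by blast
  qed
qed

end
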